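(* Let $(X,I,J,K)$ be a hypercomplex manifold and let $M\subset X$ be a submanifold of real codimension one which is strictly pseudoconvex for each of the complex structures $L=aI+bJ+cK$ on $X$ with $a,b,c\in\mathbb{R}$, $a^2+b^2+c^2=1$. Let $H\subset TM$ be the distribution whose fiber $H_x$ at $x\in M$ is the largest linear subspace of $T_xM$ that is invariant under $I$, $J$ and $K$. Then $H$ is a $3$-polycontact structure on $M$.
   Context: A hypercomplex manifold $(X,I,J,K)$ is a smooth manifold with three (integrable) complex structures $I,J,K$ satisfying the quaternionic relations. A real hypersurface $M$ in a complex manifold $(X,L)$ is strictly pseudoconvex if the hermitian Levi form of the induced CR structure on $TM\cap L(TM)$ is definite at each point (positive definite for a suitable choice of sign of the conormal). A polycontact structure on a smooth manifold $M$ is a distribution (smooth subbundle) $H\subset TM$ of corank at least $1$ such that if $\theta$ is any nonzero one-form (possibly only locally defined) that vanishes on $H$, then the restriction of $d\theta$ to $H$ is nondegenerate. A $3$-polycontact structure is a polycontact structure of corank $3$. *)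

theory Defs
  imports "HOL-Analysis.Analysis"
begin

text \<open>A function of class \<open>C\<^sup>k\<close> on an open set, and a smooth function.\<close>

fun Ck_on :: "nat \<Rightarrow> 'a::real_normed_vector set \<Rightarrow> ('a \<Rightarrow> 'b::real_normed_vector) \<Rightarrow> bool" where
  "Ck_on 0 S f \<longleftrightarrow> continuous_on S f"
| "Ck_on (Suc k) S f \<longleftrightarrow>
     (\<forall>z\<in>S. f differentiable (at z)) \<and>
     (\<forall>v. Ck_on k S (\<lambda>z. frechet_derivative f (at z) v))"

definition smooth_on :: "'a::real_normed_vector set \<Rightarrow> ('a \<Rightarrow> 'b::real_normed_vector) \<Rightarrow> bool" where
  "smooth_on S f \<longleftrightarrow> (\<forall>k. Ck_on k S f)"


section \<open>Smooth manifolds\<close>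

text \<open>A chart is a coordinate map together with its domain; outside the domain the values of
  the coordinate map are irrelevant.\<close>

type_synonym ('x, 'e) chart = "'x set \<times> ('x \<Rightarrow> 'e)"

abbreviation cdom :: "('x, 'e) chart \<Rightarrow> 'x set" where "cdom \<equiv> fst"
abbreviation cmap :: "('x, 'e) chart \<Rightarrow> 'x \<Rightarrow> 'e" where "cmap \<equiv> snd"

definition cinv :: "('x, 'e) chart \<Rightarrow> 'e \<Rightarrow> 'x" where
  "cinv c = inv_into (cdom c) (cmap c)"

definition chart_of :: "'x topology \<Rightarrow> ('x, 'e::euclidean_space) chart \<Rightarrow> bool" where
  "chart_of T c \<longleftrightarrow> openin T (cdom c) \<and> open (cmap c ` cdom c) \<and>
     homeomorphic_map (subtopology T (cdom c)) (top_of_set (cmap c ` cdom c)) (cmap c)"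

definition compatible_charts ::
    "('x, 'e::euclidean_space) chart \<Rightarrow> ('x, 'e) chart \<Rightarrow> bool" where
  "compatible_charts c d \<longleftrightarrow>
     smooth_on (cmap c ` (cdom c \<inter> cdom d)) (cmap d \<circ> cinv c) \<and>
     smooth_on (cmap d ` (cdom c \<inter> cdom d)) (cmap c \<circ> cinv d)"

record ('x, 'e) manifold =
  mtop :: "'x topology"
  atlas :: "('x, 'e) chart set"

definition carrier :: "('x, 'e) manifold \<Rightarrow> 'x set" where
  "carrier X = topspace (mtop X)"

definition smooth_manifold :: "('x, 'e::euclidean_space) manifold \<Rightarrow> bool" where
  "smooth_manifold X \<longleftrightarrow>
     Hausdorff_space (mtop X) \<and> second_countable (mtop X) \<and>
     (\<forall>c\<in>atlas X. chart_of (mtop X) c) \<and>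
     (\<Union>c\<in>atlas X. cdom c) = carrier X \<and>
     (\<forall>c\<in>atlas X. \<forall>d\<in>atlas X. compatible_charts c d)"

text \<open>A chart of the maximal atlas.\<close>

definition smooth_chart :: "('x, 'e::euclidean_space) manifold \<Rightarrow> ('x, 'e) chart \<Rightarrow> bool" where
  "smooth_chart X c \<longleftrightarrow> chart_of (mtop X) c \<and> (\<forall>d\<in>atlas X. compatible_charts c d)"


section \<open>Tangent vectors and tensor fields\<close>

text \<open>
  For every point \<open>x\<close> one chart \<open>chart_at X x\<close> around \<open>x\<close> is selected, and the tangent space
  \<open>T\<^sub>xX\<close> is the type \<open>'e\<close>: a vector \<open>v :: 'e\<close>, regarded as an element of \<open>T\<^sub>xX\<close>, is the tangent
  vector with coordinates \<open>v\<close> in \<open>chart_at X x\<close>. As \<open>chart_at X x\<close> need not depend continuously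
  on \<open>x\<close>, smoothness of a field is always tested after passing to the coordinates of a chart of
  the atlas which does not depend on the point. These are \<open>tcoord X c x v\<close>, the coordinates in
  the chart \<open>c\<close> of \<open>v \<in> T\<^sub>xX\<close>; the inverse is \<open>tvec X c x w\<close>, the element of \<open>T\<^sub>xX\<close> which has
  coordinates \<open>w\<close> in \<open>c\<close>.
\<close>

definition chart_at :: "('x, 'e) manifold \<Rightarrow> 'x \<Rightarrow> ('x, 'e) chart" where
  "chart_at X x = (SOME c. c \<in> atlas X \<and> x \<in> cdom c)"

definition tcoord ::
    "('x, 'e::euclidean_space) manifold \<Rightarrow> ('x, 'e) chart \<Rightarrow> 'x \<Rightarrow> 'e \<Rightarrow> 'e" where
  "tcoord X c x v =
     frechet_derivative (cmap c \<circ> cinv (chart_at X x)) (at (cmap (chart_at X x) x)) v"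

definition tvec ::
    "('x, 'e::euclidean_space) manifold \<Rightarrow> ('x, 'e) chart \<Rightarrow> 'x \<Rightarrow> 'e \<Rightarrow> 'e" where
  "tvec X c x w =
     frechet_derivative (cmap (chart_at X x) \<circ> cinv c) (at (cmap c x)) w"

definition smooth_vector_field_on ::
    "('x, 'e::euclidean_space) manifold \<Rightarrow> 'x set \<Rightarrow> ('x \<Rightarrow> 'e) \<Rightarrow> bool" where
  "smooth_vector_field_on X U V \<longleftrightarrow>
     (\<forall>c\<in>atlas X. smooth_on (cmap c ` (U \<inter> cdom c))
        (\<lambda>z. tcoord X c (cinv c z) (V (cinv c z))))"

text \<open>The \<open>w\<close>-component at \<open>z\<close> of a one-form in the chart \<open>c\<close>.\<close>

definition form_coord ::
    "('x, 'e::euclidean_space) manifold \<Rightarrow> ('x, 'e) chart \<Rightarrow> ('x \<Rightarrow> 'e \<Rightarrow> real) \<Rightarrow> 'e \<Rightarrow> 'e \<Rightarrow> real"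
  where
  "form_coord X c \<theta> w z = \<theta> (cinv c z) (tvec X c (cinv c z) w)"

definition smooth_one_form_on ::
    "('x, 'e::euclidean_space) manifold \<Rightarrow> 'x set \<Rightarrow> ('x \<Rightarrow> 'e \<Rightarrow> real) \<Rightarrow> bool" where
  "smooth_one_form_on X U \<theta> \<longleftrightarrow>
     (\<forall>x\<in>U. linear (\<theta> x)) \<and>
     (\<forall>c\<in>atlas X. \<forall>w. smooth_on (cmap c ` (U \<inter> cdom c)) (form_coord X c \<theta> w))"

text \<open>
  The coordinate formula \<open>d\<theta>(u, v) = \<partial>\<^sub>u(\<theta>(v)) - \<partial>\<^sub>v(\<theta>(u))\<close> for constant \<open>u\<close>, \<open>v\<close>, evaluated in
  \<open>chart_at X x\<close>, in which the elements of \<open>T\<^sub>xX\<close> are their own coordinates.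
\<close>

definition ext_deriv ::
    "('x, 'e::euclidean_space) manifold \<Rightarrow> ('x \<Rightarrow> 'e \<Rightarrow> real) \<Rightarrow> 'x \<Rightarrow> 'e \<Rightarrow> 'e \<Rightarrow> real" where
  "ext_deriv X \<theta> x u v =
     (let c = chart_at X x; z = cmap c x
      in frechet_derivative (form_coord X c \<theta> v) (at z) u
         - frechet_derivative (form_coord X c \<theta> u) (at z) v)"


section \<open>Complex and hypercomplex structures\<close>

definition almost_complex_structure ::
    "('x, 'e::euclidean_space) manifold \<Rightarrow> ('x \<Rightarrow> 'e \<Rightarrow> 'e) \<Rightarrow> bool" where
  "almost_complex_structure X L \<longleftrightarrow>
     (\<forall>x\<in>carrier X. linear (L x) \<and> (\<forall>v. L x (L x v) = - v)) \<and>
     (\<forall>c\<in>atlas X. \<forall>w. smooth_on (cmap c ` cdom c)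
        (\<lambda>z. tcoord X c (cinv c z) (L (cinv c z) (tvec X c (cinv c z) w))))"

text \<open>
  Integrability: around every point there is a holomorphic chart, that is, a smooth chart whose
  differential carries \<open>L\<close> to a constant linear complex structure \<open>L\<^sub>0\<close> of the model space. (A
  linear isomorphism from the model space with \<open>L\<^sub>0\<close> to some \<open>\<complex>\<^sup>n\<close> turns it into a chart with
  values in \<open>\<complex>\<^sup>n\<close>.)
\<close>

definition complex_structure ::
    "('x, 'e::euclidean_space) manifold \<Rightarrow> ('x \<Rightarrow> 'e \<Rightarrow> 'e) \<Rightarrow> bool" where
  "complex_structure X L \<longleftrightarrow>
     almost_complex_structure X L \<and>
     (\<forall>x\<in>carrier X. \<exists>c L\<^sub>0. smooth_chart X c \<and> x \<in> cdom c \<and>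
        linear L\<^sub>0 \<and> (\<forall>w. L\<^sub>0 (L\<^sub>0 w) = - w) \<and>
        (\<forall>y\<in>cdom c. \<forall>v. tcoord X c y (L y v) = L\<^sub>0 (tcoord X c y v)))"

definition hypercomplex_manifold ::
    "('x, 'e::euclidean_space) manifold \<Rightarrow> ('x \<Rightarrow> 'e \<Rightarrow> 'e) \<Rightarrow> ('x \<Rightarrow> 'e \<Rightarrow> 'e) \<Rightarrow>
     ('x \<Rightarrow> 'e \<Rightarrow> 'e) \<Rightarrow> bool" where
  "hypercomplex_manifold X I J K \<longleftrightarrow>
     smooth_manifold X \<and>
     complex_structure X I \<and> complex_structure X J \<and> complex_structure X K \<and>
     (\<forall>x\<in>carrier X. \<forall>v. I x (J x v) = K x v \<and> J x (I x v) = - K x v)"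


section \<open>Real hypersurfaces\<close>

text \<open>The differential at \<open>x\<close> of the inclusion of a submanifold \<open>M\<close> into \<open>X\<close>.\<close>

definition incl_deriv ::
    "('x, 'f::euclidean_space) manifold \<Rightarrow> ('x, 'e::euclidean_space) manifold \<Rightarrow> 'x \<Rightarrow> 'f \<Rightarrow> 'e"
  where
  "incl_deriv M X x v =
     frechet_derivative (cmap (chart_at X x) \<circ> cinv (chart_at M x)) (at (cmap (chart_at M x) x)) v"

text \<open>
  An (embedded) submanifold is a subset which, with the subspace topology, carries a smooth
  structure for which the inclusion is a smooth immersion.
\<close>

definition submanifold ::
    "('x, 'f::euclidean_space) manifold \<Rightarrow> ('x, 'e::euclidean_space) manifold \<Rightarrow> bool" where
  "submanifold M X \<longleftrightarrow>
     smooth_manifold M \<and> carrier M \<subseteq> carrier X \<and>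
     mtop M = subtopology (mtop X) (carrier M) \<and>
     (\<forall>d\<in>atlas M. \<forall>c\<in>atlas X. smooth_on (cmap d ` (cdom d \<inter> cdom c)) (cmap c \<circ> cinv d)) \<and>
     (\<forall>x\<in>carrier M. inj (incl_deriv M X x))"

definition real_hypersurface ::
    "('x, 'f::euclidean_space) manifold \<Rightarrow> ('x, 'e::euclidean_space) manifold \<Rightarrow> bool" where
  "real_hypersurface M X \<longleftrightarrow> submanifold M X \<and> DIM('e) = DIM('f) + 1"

text \<open>
  The CR structure of a hypersurface: the fiber of \<open>TM \<inter> L(TM)\<close> at \<open>x\<close>, as a subspace of
  \<open>T\<^sub>xM\<close>, and the complex structure induced on it by \<open>L\<close>.
\<close>

definition cr_space ::
    "('x, 'f::euclidean_space) manifold \<Rightarrow> ('x, 'e::euclidean_space) manifold \<Rightarrow>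
     ('x \<Rightarrow> 'e \<Rightarrow> 'e) \<Rightarrow> 'x \<Rightarrow> 'f set" where
  "cr_space M X L x = {v. incl_deriv M X x v \<in> L x ` range (incl_deriv M X x)}"

definition cr_operator ::
    "('x, 'f::euclidean_space) manifold \<Rightarrow> ('x, 'e::euclidean_space) manifold \<Rightarrow>
     ('x \<Rightarrow> 'e \<Rightarrow> 'e) \<Rightarrow> 'x \<Rightarrow> 'f \<Rightarrow> 'f" where
  "cr_operator M X L x v = inv (incl_deriv M X x) (L x (incl_deriv M X x v))"

text \<open>
  The hermitian Levi form with respect to a one-form \<open>\<theta>\<close> on \<open>M\<close> with kernel \<open>TM \<inter> L(TM)\<close>, as a
  form on that kernel: \<open>h(u, v) = d\<theta>(u, Lv) + i d\<theta>(u, v)\<close>, which is antilinear in \<open>u\<close> and linear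
  in \<open>v\<close>. In particular \<open>h(v, v) = d\<theta>(v, Lv)\<close>.
\<close>

definition levi_form ::
    "('x, 'f::euclidean_space) manifold \<Rightarrow> ('x, 'e::euclidean_space) manifold \<Rightarrow>
     ('x \<Rightarrow> 'e \<Rightarrow> 'e) \<Rightarrow> ('x \<Rightarrow> 'f \<Rightarrow> real) \<Rightarrow> 'x \<Rightarrow> 'f \<Rightarrow> 'f \<Rightarrow> complex" where
  "levi_form M X L \<theta> x u v =
     Complex (ext_deriv M \<theta> x u (cr_operator M X L x v)) (ext_deriv M \<theta> x u v)"

text \<open>
  Multiplying \<open>\<theta>\<close> by a nowhere vanishing function \<open>f\<close> multiplies the Levi form by \<open>f\<close>, so
  definiteness does not depend on \<open>\<theta>\<close>, and the existential quantifier amounts to choosing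
  the sign of the conormal.
\<close>

definition strictly_pseudoconvex ::
    "('x, 'f::euclidean_space) manifold \<Rightarrow> ('x, 'e::euclidean_space) manifold \<Rightarrow>
     ('x \<Rightarrow> 'e \<Rightarrow> 'e) \<Rightarrow> bool" where
  "strictly_pseudoconvex M X L \<longleftrightarrow>
     (\<forall>x\<in>carrier M. \<exists>U \<theta>. openin (mtop M) U \<and> x \<in> U \<and> smooth_one_form_on M U \<theta> \<and>
        (\<forall>y\<in>U. {v. \<theta> y v = 0} = cr_space M X L y) \<and>
        (\<forall>v\<in>cr_space M X L x. v \<noteq> 0 \<longrightarrow> Re (levi_form M X L \<theta> x v v) > 0))"


section \<open>Polycontact structures\<close>

definition smooth_distribution ::
    "('x, 'f::euclidean_space) manifold \<Rightarrow> ('x \<Rightarrow> 'f set) \<Rightarrow> bool" where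
  "smooth_distribution M H \<longleftrightarrow>
     (\<forall>x\<in>carrier M. \<exists>U k (V :: nat \<Rightarrow> 'x \<Rightarrow> 'f). openin (mtop M) U \<and> x \<in> U \<and>
        (\<forall>i<k. smooth_vector_field_on M U (V i)) \<and>
        (\<forall>y\<in>U. inj_on (\<lambda>i. V i y) {..<k} \<and> independent ((\<lambda>i. V i y) ` {..<k}) \<and>
                span ((\<lambda>i. V i y) ` {..<k}) = H y))"

definition polycontact_structure ::
    "('x, 'f::euclidean_space) manifold \<Rightarrow> ('x \<Rightarrow> 'f set) \<Rightarrow> bool" where
  "polycontact_structure M H \<longleftrightarrow>
     smooth_distribution M H \<and>
     (\<forall>x\<in>carrier M. DIM('f) - dim (H x) \<ge> 1) \<and>
     (\<forall>U \<theta>. openin (mtop M) U \<longrightarrow> smooth_one_form_on M U \<theta> \<longrightarrow>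
        (\<forall>x\<in>U. \<forall>v\<in>H x. \<theta> x v = 0) \<longrightarrow>
        (\<forall>x\<in>U. \<exists>v. \<theta> x v \<noteq> 0) \<longrightarrow>
        (\<forall>x\<in>U. \<forall>u\<in>H x. (\<forall>v\<in>H x. ext_deriv M \<theta> x u v = 0) \<longrightarrow> u = 0))"

definition three_polycontact_structure ::
    "('x, 'f::euclidean_space) manifold \<Rightarrow> ('x \<Rightarrow> 'f set) \<Rightarrow> bool" where
  "three_polycontact_structure M H \<longleftrightarrow>
     polycontact_structure M H \<and> (\<forall>x\<in>carrier M. DIM('f) - dim (H x) = 3)"

text \<open>The largest subspace of \<open>T\<^sub>xM\<close> whose image in \<open>T\<^sub>xX\<close> is invariant under \<open>I\<close>, \<open>J\<close> and \<open>K\<close>.\<close>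

definition quaternionic_distribution ::
    "('x, 'f::euclidean_space) manifold \<Rightarrow> ('x, 'e::euclidean_space) manifold \<Rightarrow>
     ('x \<Rightarrow> 'e \<Rightarrow> 'e) \<Rightarrow> ('x \<Rightarrow> 'e \<Rightarrow> 'e) \<Rightarrow> ('x \<Rightarrow> 'e \<Rightarrow> 'e) \<Rightarrow> 'x \<Rightarrow> 'f set" where
  "quaternionic_distribution M X I J K x =
     (GREATEST S. subspace S \<and>
        (\<forall>L\<in>{I, J, K}. L x ` incl_deriv M X x ` S \<subseteq> incl_deriv M X x ` S))"

end

theory Submission
  imports Defs
begin

text \<open>
  The three one-forms given by strict pseudoconvexity with respect to \<open>I\<close>, \<open>J\<close> and \<open>K\<close> are
  pointwise independent, as the odd-dimensional space \<open>T\<^sub>xM\<close> is not invariant under any unit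
  combination of \<open>I\<close>, \<open>J\<close> and \<open>K\<close>, and \<open>H\<close> is their common kernel; so \<open>H\<close> is a smooth
  distribution of corank 3. Let \<open>\<theta>\<close> be a one-form vanishing on \<open>H\<close> with \<open>\<theta>\<^sub>x \<noteq> 0\<close>. Then \<open>\<theta>\<^sub>x\<close> has kernel \<open>T\<^sub>xM \<inter> L(T\<^sub>xM)\<close> for a single unit combination
  \<open>L = aI + bJ + cK\<close>. If \<open>\<eta>\<close> is the form given by strict pseudoconvexity with respect to \<open>L\<close>, then
  \<open>\<theta>\<^sub>x = s \<eta>\<^sub>x\<close> with \<open>s \<noteq> 0\<close>. For a form \<open>\<theta>\<close> annihilating \<open>H\<close>, the restriction
  of \<open>d\<theta>\<close> to \<open>H\<^sub>x\<close> depends only on \<open>\<theta>\<^sub>x\<close>, and hence \<open>d\<theta>(u, Lu) = s d\<eta>(u, Lu) \<noteq> 0\<close> for \<open>0 \<noteq> u \<in> H\<^sub>x\<close>.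
\<close>

section \<open>Calculus of smooth functions\<close>

lemma Ck_on_mono: "Ck_on k S f \<Longrightarrow> T \<subseteq> S \<Longrightarrow> Ck_on k T f"
  by (induction k arbitrary: f) (auto intro: continuous_on_subset)

text \<open>\<open>frechet_derivative\<close> is taken at the full filter \<open>at z\<close>, so it
  also sees values off \<open>S\<close>; openness makes agreement on \<open>S\<close> determine the
  derivatives there.\<close>

lemma Ck_on_cong:
  assumes "open S" and "\<And>z. z \<in> S \<Longrightarrow> f z = g z" and "Ck_on k S f"
  shows "Ck_on k S g"
  using assms(2,3)
proof (induction k arbitrary: f g)
  case 0
  then show ?case by (simp cong: continuous_on_cong)
next
  case (Suc k)
  have "g differentiable (at z)" if "z \<in> S" for z
    using Suc.prems that \<open>open S\<close> unfolding differentiable_def Ck_on.simps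
    by (metis has_derivative_transform_within_open)
  moreover have "Ck_on k S (\<lambda>z. frechet_derivative g (at z) v)" for v
  proof (rule Suc.IH)
    show "frechet_derivative f (at z) v = frechet_derivative g (at z) v" if "z \<in> S" for z
      using frechet_derivative_transform_within_open[of f z S g] Suc.prems that \<open>open S\<close> by simp
    show "Ck_on k S (\<lambda>z. frechet_derivative f (at z) v)"
      using Suc.prems by simp
  qed
  ultimately show ?case by simp
qed

text \<open>The recursion does not list the lower orders. They come from the base case, where
  differentiability gives continuity, by descending to the directional derivatives.\<close>

lemma Ck_on_SucD: "Ck_on (Suc k) S f \<Longrightarrow> Ck_on k S f"
proof (induction k arbitrary: f)
  case 0
  then show ?case
    by (auto intro!: continuous_at_imp_continuous_on differentiable_imp_continuous_within)
next
  case (Suc k)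
  have "Ck_on k S (\<lambda>z. frechet_derivative f (at z) v)" for v
    using Suc.prems by (intro Suc.IH) (metis Ck_on.simps(2))
  then show ?case
    using Suc.prems by simp
qed

text \<open>Since derivatives are unique, any explicit formula may replace the chosen
  \<open>frechet_derivative\<close>. The closure properties below differentiate by rule and pass the
  result to the induction hypothesis.\<close>

lemma Ck_on_SucI:
  assumes "open S" and "\<And>z. z \<in> S \<Longrightarrow> (f has_derivative D z) (at z)"
    and "\<And>v. Ck_on k S (\<lambda>z. D z v)"
  shows "Ck_on (Suc k) S f"
proof -
  have "frechet_derivative f (at z) = D z" if "z \<in> S" for z
    using assms(2)[OF that] by (rule frechet_derivative_at[symmetric])
  then have "Ck_on k S (\<lambda>z. frechet_derivative f (at z) v)" for v
    by (intro Ck_on_cong[OF assms(1) _ assms(3)[of v]]) simp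
  then show ?thesis
    using assms(2) by (auto simp: differentiable_def)
qed

lemma Ck_on_const: "Ck_on k S (\<lambda>z. c)"
  by (induction k arbitrary: c) auto

lemma Ck_on_has_derivative:
  "Ck_on (Suc k) S f \<Longrightarrow> z \<in> S \<Longrightarrow> (f has_derivative frechet_derivative f (at z)) (at z)"
  by (simp flip: frechet_derivative_works)

section \<open>Sums, products, inverses and compositions of class C^k\<close>

lemma Ck_on_add:
  "open S \<Longrightarrow> Ck_on k S f \<Longrightarrow> Ck_on k S g \<Longrightarrow> Ck_on k S (\<lambda>z. f z + g z)"
proof (induction k arbitrary: f g)
  case (Suc k)
  show ?case
  proof (rule Ck_on_SucI[OF \<open>open S\<close>])
    show "((\<lambda>z. f z + g z) has_derivative
        (\<lambda>v. frechet_derivative f (at z) v + frechet_derivative g (at z) v)) (at z)"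
      if "z \<in> S" for z
      using Suc.prems that by (intro has_derivative_add Ck_on_has_derivative[where k = k])
    show "Ck_on k S (\<lambda>z. frechet_derivative f (at z) v + frechet_derivative g (at z) v)" for v
      using Suc by simp
  qed
qed (auto intro: continuous_on_add)

text \<open>Leibniz rule: each summand pairs one factor with a derivative of the other, so order
  \<open>k\<close> of both suffices. The form for bounded bilinear maps serves multiplication,
  scaling and inner products alike.\<close>

lemma Ck_on_bilinear:
  assumes "bounded_bilinear P"
  shows "open S \<Longrightarrow> Ck_on k S f \<Longrightarrow> Ck_on k S g \<Longrightarrow> Ck_on k S (\<lambda>z. P (f z) (g z))"
proof (induction k arbitrary: f g)
  case (Suc k)
  show ?case
  proof (rule Ck_on_SucI[OF \<open>open S\<close>])
    show "((\<lambda>z. P (f z) (g z)) has_derivative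
        (\<lambda>v. P (f z) (frechet_derivative g (at z) v) + P (frechet_derivative f (at z) v) (g z))) (at z)"
      if "z \<in> S" for z
      using Suc.prems that by (intro bounded_bilinear.FDERIV[OF assms] Ck_on_has_derivative[where k = k])
    show "Ck_on k S (\<lambda>z. P (f z) (frechet_derivative g (at z) v) + P (frechet_derivative f (at z) v) (g z))"
      for v
      using Suc.prems Ck_on_SucD[of k S f] Ck_on_SucD[of k S g]
      by (intro Ck_on_add Suc.IH) auto
  qed
qed (auto intro: bounded_bilinear.continuous_on[OF assms])

text \<open>The derivative is -f'/f^2, in which the inverse itself occurs only to order
  \<open>k\<close>, where the induction hypothesis supplies it.\<close>

lemma Ck_on_inverse:
  fixes f :: "'a::real_normed_vector \<Rightarrow> real"
  shows "open S \<Longrightarrow> Ck_on k S f \<Longrightarrow> (\<And>z. z \<in> S \<Longrightarrow> f z \<noteq> 0) \<Longrightarrow> Ck_on k S (\<lambda>z. inverse (f z))"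
proof (induction k)
  case (Suc k)
  show ?case
  proof (rule Ck_on_SucI[OF \<open>open S\<close>])
    show "((\<lambda>z. inverse (f z)) has_derivative
        (\<lambda>v. (-1) * (inverse (f z) * frechet_derivative f (at z) v * inverse (f z)))) (at z)"
      if "z \<in> S" for z
      using Suc.prems that by (auto intro!: derivative_eq_intros Ck_on_has_derivative[where k = k])
    show "Ck_on k S (\<lambda>z. (-1) * (inverse (f z) * frechet_derivative f (at z) v * inverse (f z)))" for v
      using Suc Ck_on_SucD[of k S f]
      by (intro Ck_on_bilinear[OF bounded_bilinear_mult] Ck_on_const) auto
  qed
qed (auto intro: continuous_on_inverse)

lemma Ck_on_sum:
  "open S \<Longrightarrow> (\<And>i. i \<in> A \<Longrightarrow> Ck_on k S (f i)) \<Longrightarrow> Ck_on k S (\<lambda>z. \<Sum>i\<in>A. f i z)"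
  by (induction A rule: infinite_finite_induct) (auto intro: Ck_on_const Ck_on_add)

text \<open>In the chain rule the direction \<open>?Df z v\<close> fed to \<open>?Dg (f z)\<close>
  varies with \<open>z\<close>, while \<open>Ck_on\<close> controls derivatives in fixed directions
  only. Expanding the direction in \<open>Basis\<close> reduces to fixed ones; this is why the
  middle space is Euclidean.\<close>

lemma Ck_on_compose:
  fixes f :: "'a::real_normed_vector \<Rightarrow> 'b::euclidean_space"
  shows "open S \<Longrightarrow> Ck_on k S f \<Longrightarrow> Ck_on k T g \<Longrightarrow> f ` S \<subseteq> T \<Longrightarrow> Ck_on k S (g \<circ> f)"
proof (induction k arbitrary: g)
  case 0
  then show ?case by (auto simp: o_def intro: continuous_on_compose2)
next
  case (Suc k)
  let ?Df = "\<lambda>z. frechet_derivative f (at z)" and ?Dg = "\<lambda>z. frechet_derivative g (at z)"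
  have eq: "?Dg (f z) (?Df z v) = (\<Sum>b\<in>Basis. (?Df z v \<bullet> b) *\<^sub>R (?Dg (f z) b))" if "z \<in> S" for z v
  proof -
    have "linear (?Dg (f z))"
      using Suc.prems that by (auto intro!: linear_frechet_derivative)
    then show ?thesis
      by (subst euclidean_representation[symmetric])
        (simp only: linear_sum linear_cmul)
  qed
  show ?case
  proof (rule Ck_on_SucI[OF \<open>open S\<close>])
    show "((g \<circ> f) has_derivative (\<lambda>v. ?Dg (f z) (?Df z v))) (at z)" if "z \<in> S" for z
      using diff_chain_at[of f "?Df z" z g "?Dg (f z)"] Suc.prems that
      by (auto simp: o_def frechet_derivative_works)
    show "Ck_on k S (\<lambda>z. ?Dg (f z) (?Df z v))" for v
    proof (rule Ck_on_cong[OF \<open>open S\<close> eq[symmetric]])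
      have "Ck_on k S ((\<lambda>z. ?Dg z b) \<circ> f)" for b
        using Suc.prems Ck_on_SucD[of k S f] by (intro Suc.IH) auto
      then show "Ck_on k S (\<lambda>z. \<Sum>b\<in>Basis. (?Df z v \<bullet> b) *\<^sub>R (?Dg (f z) b))"
        using Suc.prems unfolding o_def
        by (intro Ck_on_sum Ck_on_bilinear[OF bounded_bilinear_scaleR]
            Ck_on_bilinear[OF bounded_bilinear_inner] Ck_on_const) auto
    qed
  qed
qed

section \<open>Smooth functions\<close>

lemma smooth_on_subset: "smooth_on S f \<Longrightarrow> T \<subseteq> S \<Longrightarrow> smooth_on T f"
  unfolding smooth_on_def by (blast intro: Ck_on_mono)

lemma smooth_on_cong:
  "open S \<Longrightarrow> (\<And>z. z \<in> S \<Longrightarrow> f z = g z) \<Longrightarrow> smooth_on S f \<Longrightarrow> smooth_on S g"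
  unfolding smooth_on_def by (blast intro: Ck_on_cong)

lemma smooth_on_add:
  "open S \<Longrightarrow> smooth_on S f \<Longrightarrow> smooth_on S g \<Longrightarrow> smooth_on S (\<lambda>z. f z + g z)"
  by (simp add: smooth_on_def Ck_on_add)

lemma smooth_on_scaleR:
  "open S \<Longrightarrow> smooth_on S f \<Longrightarrow> smooth_on S g \<Longrightarrow> smooth_on S (\<lambda>z. f z *\<^sub>R g z)"
  by (simp add: smooth_on_def Ck_on_bilinear[OF bounded_bilinear_scaleR])

lemma smooth_on_inner_const:
  "open S \<Longrightarrow> smooth_on S f \<Longrightarrow> smooth_on S (\<lambda>z. f z \<bullet> c)"
  by (simp add: smooth_on_def Ck_on_bilinear[OF bounded_bilinear_inner] Ck_on_const)

lemma smooth_on_inverse: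
  fixes f :: "'a::real_normed_vector \<Rightarrow> real"
  shows "open S \<Longrightarrow> smooth_on S f \<Longrightarrow> (\<And>z. z \<in> S \<Longrightarrow> f z \<noteq> 0) \<Longrightarrow> smooth_on S (\<lambda>z. inverse (f z))"
  by (simp add: smooth_on_def Ck_on_inverse)

lemma smooth_on_sum:
  "open S \<Longrightarrow> (\<And>i. i \<in> A \<Longrightarrow> smooth_on S (f i)) \<Longrightarrow> smooth_on S (\<lambda>z. \<Sum>i\<in>A. f i z)"
  by (simp add: smooth_on_def Ck_on_sum)

lemma smooth_on_const: "smooth_on S (\<lambda>z. c)"
  by (simp add: smooth_on_def Ck_on_const)

lemma smooth_on_compose:
  fixes f :: "'a::real_normed_vector \<Rightarrow> 'b::euclidean_space"
  shows "open S \<Longrightarrow> smooth_on S f \<Longrightarrow> smooth_on T g \<Longrightarrow> f ` S \<subseteq> T \<Longrightarrow> smooth_on S (g \<circ> f)"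
  unfolding smooth_on_def by (blast intro: Ck_on_compose)

lemma smooth_on_differentiable: "smooth_on S f \<Longrightarrow> z \<in> S \<Longrightarrow> f differentiable (at z)"
  unfolding smooth_on_def by (metis Ck_on.simps(2))

lemma smooth_on_frechet_derivative:
  "smooth_on S f \<Longrightarrow> smooth_on S (\<lambda>z. frechet_derivative f (at z) v)"
  unfolding smooth_on_def by (metis Ck_on.simps(2))

lemma smooth_on_continuous: "smooth_on S f \<Longrightarrow> continuous_on S f"
  unfolding smooth_on_def by (metis Ck_on.simps(1))

section \<open>Charts and smooth fields\<close>

lemma
  assumes "chart_of T c"
  shows cdom_subset: "cdom c \<subseteq> topspace T"
    and openin_cdom: "openin T (cdom c)"
    and inj_on_cmap: "inj_on (cmap c) (cdom c)"
    and open_cmap_image: "openin T U \<Longrightarrow> open (cmap c ` (U \<inter> cdom c))"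
    and openin_cmap_vimage: "open W \<Longrightarrow> openin T {y \<in> cdom c. cmap c y \<in> W}"
proof -
  show o: "openin T (cdom c)"
    using assms by (simp add: chart_of_def)
  then show sub: "cdom c \<subseteq> topspace T"
    by (rule openin_subset)
  have h: "homeomorphic_map (subtopology T (cdom c)) (top_of_set (cmap c ` cdom c)) (cmap c)"
    and oi: "open (cmap c ` cdom c)"
    using assms by (auto simp: chart_of_def)
  have ts: "topspace (subtopology T (cdom c)) = cdom c"
    using sub by auto
  show "inj_on (cmap c) (cdom c)"
    using h ts by (metis homeomorphic_imp_injective_map)
  show "open (cmap c ` (U \<inter> cdom c))" if "openin T U"
  proof -
    have "openin (subtopology T (cdom c)) (U \<inter> cdom c)"
      using that by (rule openin_subtopology_Int)
    then have "openin (top_of_set (cmap c ` cdom c)) (cmap c ` (U \<inter> cdom c))"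
      using homeomorphic_imp_open_map[OF h] by (simp add: open_map_def)
    then show ?thesis
      using oi openin_open_eq by blast
  qed
  show "openin T {y \<in> cdom c. cmap c y \<in> W}" if "open W"
  proof -
    have "openin (top_of_set (cmap c ` cdom c)) (cmap c ` cdom c \<inter> W)"
      using that by (rule openin_open_Int)
    then have "openin (subtopology T (cdom c))
        {y \<in> topspace (subtopology T (cdom c)). cmap c y \<in> cmap c ` cdom c \<inter> W}"
      using homeomorphic_imp_continuous_map[OF h] openin_continuous_map_preimage by blast
    then have "openin T {y \<in> topspace (subtopology T (cdom c)). cmap c y \<in> cmap c ` cdom c \<inter> W}"
      using o openin_trans_full by blast
    moreover have "{y \<in> topspace (subtopology T (cdom c)). cmap c y \<in> cmap c ` cdom c \<inter> W}
        = {y \<in> cdom c. cmap c y \<in> W}"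
      unfolding ts by auto
    ultimately show ?thesis by simp
  qed
qed

lemma cinv_cmap: "chart_of T c \<Longrightarrow> y \<in> cdom c \<Longrightarrow> cinv c (cmap c y) = y"
  by (simp add: cinv_def inj_on_cmap inv_into_f_f)

text \<open>Both \<open>tcoord\<close> and \<open>tvec\<close> are differentials of transition maps,
  with \<open>chart_at\<close> as source or target. Their identities thus become instances of one
  cocycle rule.\<close>

definition chart_deriv :: "('x, 'e::euclidean_space) chart \<Rightarrow> ('x, 'e) chart \<Rightarrow> 'x \<Rightarrow> 'e \<Rightarrow> 'e" where
  "chart_deriv c d y = frechet_derivative (cmap d \<circ> cinv c) (at (cmap c y))"

lemma tcoord_eq: "tcoord M c x = chart_deriv (chart_at M x) c x"
  and tvec_eq: "tvec M c x = chart_deriv c (chart_at M x) x"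
  by (auto simp: tcoord_def tvec_def chart_deriv_def fun_eq_iff)

definition smooth_function_on ::
    "('x, 'e::euclidean_space) manifold \<Rightarrow> 'x set \<Rightarrow> ('x \<Rightarrow> real) \<Rightarrow> bool" where
  "smooth_function_on M U g \<longleftrightarrow>
     (\<forall>c\<in>atlas M. smooth_on (cmap c ` (U \<inter> cdom c)) (\<lambda>z. g (cinv c z)))"

text \<open>Members are indexed by an arbitrary finite set, and independence and spanning are
  phrased through coefficient families. Elimination can then just delete an index, and coinciding
  vectors in an image set cause no trouble.\<close>

definition local_frame ::
    "('x, 'e::euclidean_space) manifold \<Rightarrow> 'x set \<Rightarrow> 'i set \<Rightarrow> ('i \<Rightarrow> 'x \<Rightarrow> 'e) \<Rightarrow>
     ('x \<Rightarrow> 'e set) \<Rightarrow> bool" where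
  "local_frame M U A V D \<longleftrightarrow>
     openin (mtop M) U \<and> finite A \<and> (\<forall>i\<in>A. smooth_vector_field_on M U (V i)) \<and>
     (\<forall>y\<in>U. (\<forall>c. (\<Sum>i\<in>A. c i *\<^sub>R V i y) = 0 \<longrightarrow> (\<forall>i\<in>A. c i = 0)) \<and>
             D y = range (\<lambda>c. \<Sum>i\<in>A. c i *\<^sub>R V i y))"

lemma smooth_vector_field_on_subset:
  "smooth_vector_field_on M U V \<Longrightarrow> W \<subseteq> U \<Longrightarrow> smooth_vector_field_on M W V"
  unfolding smooth_vector_field_on_def by (meson Int_mono image_mono order_refl smooth_on_subset)

lemma smooth_one_form_on_subset:
  "smooth_one_form_on M U \<theta> \<Longrightarrow> W \<subseteq> U \<Longrightarrow> smooth_one_form_on M W \<theta>"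
  unfolding smooth_one_form_on_def by (meson Int_mono image_mono order_refl smooth_on_subset subsetD)

context
  fixes M :: "('x, 'e::euclidean_space) manifold"
  assumes mf: "smooth_manifold M"
begin

lemma atlas_chart_of: "c \<in> atlas M \<Longrightarrow> chart_of (mtop M) c"
  using mf by (simp add: smooth_manifold_def)

lemma cdom_carrier: "c \<in> atlas M \<Longrightarrow> y \<in> cdom c \<Longrightarrow> y \<in> carrier M"
  using mf by (auto simp: smooth_manifold_def)

lemma chart_at:
  assumes "x \<in> carrier M"
  shows chart_at_atlas: "chart_at M x \<in> atlas M" and chart_at_cdom: "x \<in> cdom (chart_at M x)"
proof -
  have "x \<in> (\<Union>c\<in>atlas M. cdom c)"
    using mf assms by (simp add: smooth_manifold_def)
  then have "\<exists>c. c \<in> atlas M \<and> x \<in> cdom c"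
    by blast
  then have "chart_at M x \<in> atlas M \<and> x \<in> cdom (chart_at M x)"
    unfolding chart_at_def by (rule someI_ex)
  then show "chart_at M x \<in> atlas M" "x \<in> cdom (chart_at M x)" by auto
qed

lemma smooth_transition:
  "c \<in> atlas M \<Longrightarrow> d \<in> atlas M \<Longrightarrow>
    smooth_on (cmap c ` (cdom c \<inter> cdom d)) (cmap d \<circ> cinv c)"
  using mf by (auto simp: smooth_manifold_def compatible_charts_def)

lemma differentiable_transition:
  assumes "c \<in> atlas M" "d \<in> atlas M" "y \<in> cdom c" "y \<in> cdom d"
  shows "(cmap d \<circ> cinv c) differentiable (at (cmap c y))"
  using smooth_transition[OF assms(1,2)] assms(3,4) by (auto intro: smooth_on_differentiable)

lemma linear_chart_deriv:
  "c \<in> atlas M \<Longrightarrow> d \<in> atlas M \<Longrightarrow> y \<in> cdom c \<Longrightarrow> y \<in> cdom d \<Longrightarrow> linear (chart_deriv c d y)"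
  unfolding chart_deriv_def by (intro linear_frechet_derivative differentiable_transition)

text \<open>Chain rule for transition maps: on the open image of the overlap, \<open>cinv d\<close>
  and \<open>cmap d\<close> cancel.\<close>

lemma chart_deriv_trans:
  assumes "c \<in> atlas M" "d \<in> atlas M" "e \<in> atlas M" "y \<in> cdom c" "y \<in> cdom d" "y \<in> cdom e"
  shows "chart_deriv d e y (chart_deriv c d y v) = chart_deriv c e y v"
proof -
  have y: "(cmap d \<circ> cinv c) (cmap c y) = cmap d y"
    using assms by (simp add: cinv_cmap[OF atlas_chart_of])
  have df: "(cmap d \<circ> cinv c) differentiable (at (cmap c y))"
    "(cmap e \<circ> cinv d) differentiable (at ((cmap d \<circ> cinv c) (cmap c y)))"
    unfolding y using assms by (auto intro: differentiable_transition)
  have "frechet_derivative ((cmap e \<circ> cinv d) \<circ> (cmap d \<circ> cinv c)) (at (cmap c y))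
      = frechet_derivative (cmap e \<circ> cinv c) (at (cmap c y))"
  proof (rule frechet_derivative_transform_within_open)
    show "(cmap e \<circ> cinv d) \<circ> (cmap d \<circ> cinv c) differentiable at (cmap c y)"
      using df by (rule differentiable_chain_at)
    show "open (cmap c ` (cdom d \<inter> cdom c))"
      using assms by (intro open_cmap_image[OF atlas_chart_of] openin_cdom[OF atlas_chart_of])
    show "((cmap e \<circ> cinv d) \<circ> (cmap d \<circ> cinv c)) z = (cmap e \<circ> cinv c) z"
      if "z \<in> cmap c ` (cdom d \<inter> cdom c)" for z
      using that assms by (auto simp: cinv_cmap[OF atlas_chart_of])
  qed (use assms in auto)
  then show ?thesis
    unfolding frechet_derivative_compose[OF df] y by (simp add: chart_deriv_def o_def fun_eq_iff)
qed

lemma chart_deriv_self: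
  assumes "c \<in> atlas M" "y \<in> cdom c"
  shows "chart_deriv c c y v = v"
proof -
  have "frechet_derivative (\<lambda>z. z) (at (cmap c y)) = frechet_derivative (cmap c \<circ> cinv c) (at (cmap c y))"
  proof (rule frechet_derivative_transform_within_open)
    show "open (cmap c ` (cdom c \<inter> cdom c))"
      using assms by (intro open_cmap_image[OF atlas_chart_of] openin_cdom[OF atlas_chart_of])
  qed (use assms in \<open>auto simp: cinv_cmap[OF atlas_chart_of]\<close>)
  then show ?thesis
    by (metis chart_deriv_def frechet_derivative_ident)
qed

lemma tangent_coords:
  assumes "c \<in> atlas M" "y \<in> cdom c"
  shows linear_tcoord: "linear (tcoord M c y)"
    and linear_tvec: "linear (tvec M c y)"
    and tvec_tcoord: "tvec M c y (tcoord M c y v) = v"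
    and tcoord_tvec: "d \<in> atlas M \<Longrightarrow> y \<in> cdom d \<Longrightarrow> tcoord M d y (tvec M c y v) = chart_deriv c d y v"
proof -
  note y = cdom_carrier[OF assms]
  note [simp] = chart_at[OF y] assms
  show "linear (tcoord M c y)" "linear (tvec M c y)"
    unfolding tcoord_eq tvec_eq by (auto intro: linear_chart_deriv)
  show "tvec M c y (tcoord M c y v) = v"
    unfolding tcoord_eq tvec_eq by (simp add: chart_deriv_trans chart_deriv_self)
  show "tcoord M d y (tvec M c y v) = chart_deriv c d y v" if "d \<in> atlas M" "y \<in> cdom d"
    using that unfolding tcoord_eq tvec_eq by (simp add: chart_deriv_trans)
qed

lemma tvec_chart_at: "x \<in> carrier M \<Longrightarrow> tvec M (chart_at M x) x v = v"
  by (simp add: tvec_eq chart_deriv_self chart_at)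

lemma tcoord_chart_at: "x \<in> carrier M \<Longrightarrow> tcoord M (chart_at M x) x v = v"
  by (simp add: tcoord_eq chart_deriv_self chart_at)

text \<open>In a chart \<open>c\<close> the field reads D(c o d^-1)(d(c^-1 z)) w: the chart selected
  at the point, which may jump, cancels by the cocycle rule.\<close>

lemma smooth_coordinate_field:
  assumes d: "d \<in> atlas M"
  shows "smooth_vector_field_on M (cdom d) (\<lambda>y. tvec M d y w)"
  unfolding smooth_vector_field_on_def
proof
  fix c assume c: "c \<in> atlas M"
  let ?S = "cmap c ` (cdom d \<inter> cdom c)"
  have S: "open ?S"
    using c d by (intro open_cmap_image[OF atlas_chart_of] openin_cdom[OF atlas_chart_of])
  show "smooth_on ?S (\<lambda>z. tcoord M c (cinv c z) (tvec M d (cinv c z) w))"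
  proof (rule smooth_on_cong[OF S])
    show "smooth_on ?S ((\<lambda>z. frechet_derivative (cmap c \<circ> cinv d) (at z) w) \<circ> (cmap d \<circ> cinv c))"
    proof (rule smooth_on_compose[OF S])
      show "smooth_on ?S (cmap d \<circ> cinv c)"
        using smooth_transition[OF c d] by (simp add: Int_commute)
      show "smooth_on (cmap d ` (cdom d \<inter> cdom c))
          (\<lambda>z. frechet_derivative (cmap c \<circ> cinv d) (at z) w)"
        using smooth_transition[OF d c] by (rule smooth_on_frechet_derivative)
      show "(cmap d \<circ> cinv c) ` ?S \<subseteq> cmap d ` (cdom d \<inter> cdom c)"
        using c by (auto simp: cinv_cmap[OF atlas_chart_of])
    qed
    show "((\<lambda>z. frechet_derivative (cmap c \<circ> cinv d) (at z) w) \<circ> (cmap d \<circ> cinv c)) z =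
        tcoord M c (cinv c z) (tvec M d (cinv c z) w)" if "z \<in> ?S" for z
      using that c d by (auto simp: cinv_cmap[OF atlas_chart_of] tcoord_tvec chart_deriv_def)
  qed
qed

section \<open>Smooth functions, pairings and fields in coordinates\<close>

lemma form_coord_expansion:
  assumes "linear (\<theta> y)" "c \<in> atlas M" "y \<in> cdom c"
  shows "\<theta> y (tvec M c y v) = (\<Sum>b\<in>Basis. (v \<bullet> b) *\<^sub>R form_coord M c \<theta> b (cmap c y))"
proof -
  have "linear (\<lambda>v. \<theta> y (tvec M c y v))"
    using linear_compose[OF linear_tvec[OF assms(2,3)] assms(1)] by (simp add: o_def)
  then have "\<theta> y (tvec M c y (\<Sum>b\<in>Basis. (v \<bullet> b) *\<^sub>R b))
      = (\<Sum>b\<in>Basis. (v \<bullet> b) *\<^sub>R \<theta> y (tvec M c y b))"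
    using linear_sum[OF \<open>linear (\<lambda>v. \<theta> y (tvec M c y v))\<close>, of "\<lambda>b. (v \<bullet> b) *\<^sub>R b" Basis]
      linear_cmul[OF \<open>linear (\<lambda>v. \<theta> y (tvec M c y v))\<close>] by simp
  then show ?thesis
    using assms by (simp add: euclidean_representation form_coord_def cinv_cmap[OF atlas_chart_of])
qed

text \<open>In a chart the pairing is a finite sum of components of the field times components of
  the form.\<close>

lemma smooth_function_on_pairing:
  assumes U: "openin (mtop M) U" and \<theta>: "smooth_one_form_on M U \<theta>"
    and V: "smooth_vector_field_on M U V"
  shows "smooth_function_on M U (\<lambda>y. \<theta> y (V y))"
  unfolding smooth_function_on_def
proof
  fix c assume c: "c \<in> atlas M"
  let ?S = "cmap c ` (U \<inter> cdom c)"
  have S: "open ?S"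
    using c U by (intro open_cmap_image[OF atlas_chart_of])
  show "smooth_on ?S (\<lambda>z. \<theta> (cinv c z) (V (cinv c z)))"
  proof (rule smooth_on_cong[OF S])
    show "smooth_on ?S (\<lambda>z. \<Sum>b\<in>Basis.
        (tcoord M c (cinv c z) (V (cinv c z)) \<bullet> b) *\<^sub>R form_coord M c \<theta> b z)"
      using c \<theta> V S unfolding smooth_one_form_on_def smooth_vector_field_on_def
      by (intro smooth_on_sum smooth_on_scaleR smooth_on_inner_const) auto
    show "(\<Sum>b\<in>Basis. (tcoord M c (cinv c z) (V (cinv c z)) \<bullet> b) *\<^sub>R form_coord M c \<theta> b z)
        = \<theta> (cinv c z) (V (cinv c z))" if z: "z \<in> ?S" for z
    proof -
      obtain y where y: "y \<in> U" "y \<in> cdom c" "z = cmap c y" using z by blast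
      then have "linear (\<theta> y)" using \<theta> by (simp add: smooth_one_form_on_def)
      from form_coord_expansion[of \<theta> y c "tcoord M c y (V y)", OF this c y(2)] show ?thesis
        using c y by (simp add: cinv_cmap[OF atlas_chart_of] tvec_tcoord)
    qed
  qed
qed

text \<open>Regularity of the coefficients by which Gaussian elimination corrects the members of a
  frame.\<close>

lemma smooth_function_on_neg_quotient:
  assumes U: "openin (mtop M) U" and "smooth_function_on M U f" "smooth_function_on M U g"
    and "\<And>y. y \<in> U \<Longrightarrow> g y \<noteq> 0"
  shows "smooth_function_on M U (\<lambda>y. - (f y / g y))"
  unfolding smooth_function_on_def
proof
  fix c assume c: "c \<in> atlas M"
  have "open (cmap c ` (U \<inter> cdom c))"
    using c U by (intro open_cmap_image[OF atlas_chart_of])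
  then have "smooth_on (cmap c ` (U \<inter> cdom c)) (\<lambda>z. (-1) *\<^sub>R f (cinv c z) *\<^sub>R inverse (g (cinv c z)))"
    using assms c unfolding smooth_function_on_def
    by (intro smooth_on_scaleR smooth_on_const smooth_on_inverse) (auto simp: cinv_cmap[OF atlas_chart_of])
  then show "smooth_on (cmap c ` (U \<inter> cdom c)) (\<lambda>z. - (f (cinv c z) / g (cinv c z)))"
    by (simp add: divide_inverse)
qed

text \<open>In each chart the locus is the preimage of an open set under a continuous function, and
  the atlas covers the manifold. Used to shrink to a neighbourhood where the pivot of an elimination
  stays nonzero.\<close>

lemma openin_smooth_function_nonzero:
  assumes U: "openin (mtop M) U" and g: "smooth_function_on M U g"
  shows "openin (mtop M) {y \<in> U. g y \<noteq> 0}"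
proof -
  define W where "W c = {z \<in> cmap c ` (U \<inter> cdom c). g (cinv c z) \<noteq> 0}" for c :: "('x, 'e) chart"
  have "open (W c)" if "c \<in> atlas M" for c
  proof -
    have "open (cmap c ` (U \<inter> cdom c))"
      using that U by (intro open_cmap_image[OF atlas_chart_of])
    moreover have "continuous_on (cmap c ` (U \<inter> cdom c)) (\<lambda>z. g (cinv c z))"
      using that g by (simp add: smooth_function_on_def smooth_on_continuous)
    ultimately have "open ((\<lambda>z. g (cinv c z)) -` (- {0}) \<inter> cmap c ` (U \<inter> cdom c))"
      using continuous_on_open_vimage by blast
    also have "(\<lambda>z. g (cinv c z)) -` (- {0}) \<inter> cmap c ` (U \<inter> cdom c) = W c"
      by (auto simp: W_def)
    finally show ?thesis .
  qed
  then have "openin (mtop M) (\<Union>c\<in>atlas M. {y \<in> cdom c. cmap c y \<in> W c})"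
    by (intro openin_Union) (auto intro: openin_cmap_vimage[OF atlas_chart_of])
  moreover have "(\<Union>c\<in>atlas M. {y \<in> cdom c. cmap c y \<in> W c}) = {y \<in> U. g y \<noteq> 0}" (is "?L = ?R")
  proof
    show "?L \<subseteq> ?R"
    proof
      fix y assume "y \<in> ?L"
      then obtain c y' where *: "c \<in> atlas M" "y \<in> cdom c" "g (cinv c (cmap c y)) \<noteq> 0"
        "y' \<in> U" "y' \<in> cdom c" "cmap c y = cmap c y'"
        by (auto simp: W_def)
      then have "y = y'"
        by (metis cinv_cmap atlas_chart_of)
      then show "y \<in> ?R"
        using * by (simp add: cinv_cmap[OF atlas_chart_of])
    qed
    show "?R \<subseteq> ?L"
    proof
      fix y assume y: "y \<in> ?R"
      then have "y \<in> carrier M"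
        using U openin_subset unfolding carrier_def by blast
      then show "y \<in> ?L"
        using y chart_at[of y] cinv_cmap[OF atlas_chart_of, of "chart_at M y" y]
        by (intro UN_I[of "chart_at M y"]) (auto simp: W_def)
    qed
  qed
  ultimately show ?thesis by simp
qed

lemma smooth_vector_field_on_add_scaleR:
  assumes U: "openin (mtop M) U" and "smooth_vector_field_on M U V"
    "smooth_function_on M U f" "smooth_vector_field_on M U W"
  shows "smooth_vector_field_on M U (\<lambda>y. V y + f y *\<^sub>R W y)"
  unfolding smooth_vector_field_on_def
proof
  fix c assume c: "c \<in> atlas M"
  let ?S = "cmap c ` (U \<inter> cdom c)"
  have S: "open ?S"
    using c U by (intro open_cmap_image[OF atlas_chart_of])
  show "smooth_on ?S (\<lambda>z. tcoord M c (cinv c z) (V (cinv c z) + f (cinv c z) *\<^sub>R W (cinv c z)))"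
  proof (rule smooth_on_cong[OF S])
    show "smooth_on ?S (\<lambda>z. tcoord M c (cinv c z) (V (cinv c z))
        + f (cinv c z) *\<^sub>R tcoord M c (cinv c z) (W (cinv c z)))"
      using assms c S unfolding smooth_function_on_def smooth_vector_field_on_def
      by (intro smooth_on_add smooth_on_scaleR) auto
    show "tcoord M c (cinv c z) (V (cinv c z)) + f (cinv c z) *\<^sub>R tcoord M c (cinv c z) (W (cinv c z))
        = tcoord M c (cinv c z) (V (cinv c z) + f (cinv c z) *\<^sub>R W (cinv c z))" if "z \<in> ?S" for z
      using that c linear_tcoord[OF c]
      by (auto simp: cinv_cmap[OF atlas_chart_of] linear_add linear_cmul)
  qed
qed

end

section \<open>Local frames and annihilating one-forms\<close>

lemma local_frameD:
  assumes "local_frame M U A V D"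
  shows local_frame_openin: "openin (mtop M) U" and local_frame_finite: "finite A"
    and local_frame_smooth: "i \<in> A \<Longrightarrow> smooth_vector_field_on M U (V i)"
  using assms unfolding local_frame_def by blast+

lemma local_frame_dim:
  assumes F: "local_frame M U A V D" and y: "y \<in> U"
  shows inj_on_local_frame: "inj_on (\<lambda>i. V i y) A"
    and independent_local_frame: "independent ((\<lambda>i. V i y) ` A)"
    and span_local_frame: "span ((\<lambda>i. V i y) ` A) = D y"
    and dim_local_frame: "dim (D y) = card A"
proof -
  have fin: "finite A" and D: "D y = range (\<lambda>c. \<Sum>i\<in>A. c i *\<^sub>R V i y)"
    and ind: "\<And>c. (\<Sum>i\<in>A. c i *\<^sub>R V i y) = 0 \<Longrightarrow> \<forall>i\<in>A. c i = 0"
    using F y by (auto simp: local_frame_def)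
  show inj: "inj_on (\<lambda>i. V i y) A"
  proof (rule inj_onI)
    fix i j assume ij: "i \<in> A" "j \<in> A" "V i y = V j y"
    show "i = j"
    proof (rule ccontr)
      assume "i \<noteq> j"
      \<comment> \<open>Coefficients 1 at \<open>i\<close> and -1 at \<open>j\<close> give a
        nontrivial relation when the two vectors coincide.\<close>
      have "(\<Sum>k\<in>A. ((if k = i then 1 else 0) - (if k = j then 1 else 0)) *\<^sub>R V k y)
          = (\<Sum>k\<in>A. (if k = i then V k y else 0)) - (\<Sum>k\<in>A. (if k = j then V k y else 0))"
        by (subst sum_subtractf[symmetric], rule sum.cong) auto
      also have "\<dots> = 0"
        using ij fin by simp
      finally show False
        using ij(1) \<open>i \<noteq> j\<close> by (auto dest!: ind bspec[of A _ i])
    qed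
  qed
  have fin': "finite ((\<lambda>i. V i y) ` A)"
    using fin by simp
  have re: "(\<Sum>v\<in>(\<lambda>i. V i y) ` A. u v *\<^sub>R v) = (\<Sum>i\<in>A. u (V i y) *\<^sub>R V i y)" for u
    by (simp add: sum.reindex[OF inj])
  show ind': "independent ((\<lambda>i. V i y) ` A)"
    unfolding independent_explicit re
  proof (intro conjI allI impI ballI fin')
    fix u v assume "(\<Sum>i\<in>A. u (V i y) *\<^sub>R V i y) = 0" "v \<in> (\<lambda>i. V i y) ` A"
    then show "u v = 0"
      by (auto dest!: ind)
  qed
  show sp: "span ((\<lambda>i. V i y) ` A) = D y"
    unfolding span_finite[OF fin'] D re
  proof (intro equalityI subsetI; elim rangeE; hypsubst)
    fix c
    \<comment> \<open>Injectivity transports coefficients on indices to coefficients on vectors, as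
      \<open>span_finite\<close> expects.\<close>
    have "(\<Sum>i\<in>A. c i *\<^sub>R V i y)
        = (\<Sum>i\<in>A. (c \<circ> the_inv_into A (\<lambda>i. V i y)) (V i y) *\<^sub>R V i y)"
      by (intro sum.cong) (simp_all add: the_inv_into_f_f[OF inj])
    then show "(\<Sum>i\<in>A. c i *\<^sub>R V i y) \<in> range (\<lambda>u. \<Sum>i\<in>A. u (V i y) *\<^sub>R V i y)"
      by (rule range_eqI[of _ _ "c \<circ> the_inv_into A (\<lambda>i. V i y)"])
  qed (rule rangeI)
  show "dim (D y) = card A"
    unfolding sp[symmetric] dim_span using ind' inj by (simp add: dim_eq_card_independent card_image)
qed

lemma local_frame_subset:
  assumes "local_frame M U A V D" "openin (mtop M) W" "W \<subseteq> U"
  shows "local_frame M W A V D"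
  using assms unfolding local_frame_def
  by (auto intro: smooth_vector_field_on_subset)

lemma local_frame_cong:
  assumes "local_frame M U A V D" "\<And>y. y \<in> U \<Longrightarrow> D y = E y"
  shows "local_frame M U A V E"
  using assms unfolding local_frame_def by simp

context
  fixes M :: "('x, 'e::euclidean_space) manifold"
  assumes mf: "smooth_manifold M"
begin

text \<open>The starting point of the elimination. At each point \<open>tvec M d y\<close> is a
  linear isomorphism inverse to \<open>tcoord M d y\<close>, so it carries \<open>Basis\<close> to a
  basis.\<close>

lemma local_frame_tangent:
  assumes d: "d \<in> atlas M"
  shows "local_frame M (cdom d) Basis (\<lambda>b y. tvec M d y b) (\<lambda>y. UNIV)"
  unfolding local_frame_def
proof (intro conjI ballI)
  show "openin (mtop M) (cdom d)"
    using d by (intro openin_cdom[OF atlas_chart_of[OF mf]])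
  show "smooth_vector_field_on M (cdom d) (\<lambda>y. tvec M d y b)" for b
    using d by (rule smooth_coordinate_field[OF mf])
  fix y assume y: "y \<in> cdom d"
  have lin: "linear (tvec M d y)"
    using d y by (rule linear_tvec[OF mf])
  have sum: "(\<Sum>b\<in>Basis. c b *\<^sub>R tvec M d y b) = tvec M d y (\<Sum>b\<in>Basis. c b *\<^sub>R b)" for c
    by (simp add: linear_sum[OF lin] linear_cmul[OF lin])
  have tt: "tcoord M d y (tvec M d y v) = v" for v
    unfolding tcoord_tvec[OF mf d y d y] using d y by (rule chart_deriv_self[OF mf])
  have inj: "v = 0" if "tvec M d y v = 0" for v
    using tt[of v] unfolding that linear_0[OF linear_tcoord[OF mf d y]] by (rule sym)
  show "\<forall>c. (\<Sum>b\<in>Basis. c b *\<^sub>R tvec M d y b) = 0 \<longrightarrow> (\<forall>b\<in>Basis. c b = 0)"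
  proof (intro allI impI ballI)
    fix c and b :: 'e assume *: "(\<Sum>b\<in>Basis. c b *\<^sub>R tvec M d y b) = 0" "b \<in> Basis"
    from *(1) have "(\<Sum>b\<in>Basis. c b *\<^sub>R b) = 0"
      unfolding sum by (rule inj)
    then have "(\<Sum>b\<in>Basis. c b *\<^sub>R b) \<bullet> b = 0"
      by (simp only: inner_zero_left)
    then show "c b = 0"
      by (simp only: inner_sum_left_Basis[OF *(2)])
  qed
  show "UNIV = range (\<lambda>c. \<Sum>b\<in>Basis. c b *\<^sub>R tvec M d y b)"
  proof -
    have "v \<in> range (\<lambda>c. \<Sum>b\<in>Basis. c b *\<^sub>R tvec M d y b)" for v
      unfolding sum by (rule range_eqI[of _ _ "\<lambda>b. tcoord M d y v \<bullet> b"])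
        (simp add: euclidean_representation tvec_tcoord[OF mf d y])
    then show ?thesis by blast
  qed
qed simp

text \<open>One step of Gaussian elimination: the field \<open>V i\<close>, on which \<open>\<theta>\<close> does not vanish, is used to
  clear \<open>\<theta>\<close> on the other members of the frame.\<close>

lemma local_frame_kernel:
  assumes F: "local_frame M U A V D" and \<theta>: "smooth_one_form_on M U \<theta>"
    and x: "x \<in> U" and w: "w \<in> D x" "\<theta> x w \<noteq> 0"
  obtains W i V' where "W \<subseteq> U" "x \<in> W" "i \<in> A"
    "local_frame M W (A - {i}) V' (\<lambda>y. {v \<in> D y. \<theta> y v = 0})"
proof -
  have U: "openin (mtop M) U" and fin: "finite A"
    and V: "\<And>i. i \<in> A \<Longrightarrow> smooth_vector_field_on M U (V i)"
    and D: "\<And>y. y \<in> U \<Longrightarrow> D y = range (\<lambda>c. \<Sum>i\<in>A. c i *\<^sub>R V i y)"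
    and ind: "\<And>c y. y \<in> U \<Longrightarrow> (\<Sum>i\<in>A. c i *\<^sub>R V i y) = 0 \<Longrightarrow> \<forall>i\<in>A. c i = 0"
    using F by (auto simp: local_frame_def)
  have lin: "linear (\<theta> y)" if "y \<in> U" for y
    using \<theta> that by (simp add: smooth_one_form_on_def)
  have \<theta>_sum: "\<theta> y (\<Sum>j\<in>A. c j *\<^sub>R V j y) = (\<Sum>j\<in>A. c j * \<theta> y (V j y))" if "y \<in> U" for y c
    by (simp add: linear_sum[OF lin[OF that]] linear_cmul[OF lin[OF that]])
  \<comment> \<open>A vector of \<open>D x\<close> off the kernel of \<theta> forces some member of
    the frame off the kernel; its index \<open>i\<close> is the pivot.\<close>
  obtain c where "w = (\<Sum>j\<in>A. c j *\<^sub>R V j x)"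
    using w(1) D[OF x] by auto
  then have "(\<Sum>j\<in>A. c j * \<theta> x (V j x)) \<noteq> 0"
    using w(2) \<theta>_sum[OF x, of c] by simp
  then obtain i where "i \<in> A" "c i * \<theta> x (V i x) \<noteq> 0"
    by (rule sum.not_neutral_contains_not_neutral)
  then have i: "i \<in> A" "\<theta> x (V i x) \<noteq> 0"
    by auto
  define g where "g y = \<theta> y (V i y)" for y
  define f where "f j y = - (\<theta> y (V j y) / g y)" for j y
  define W where "W = {y \<in> U. g y \<noteq> 0}"
  define V' where "V' j y = V j y + f j y *\<^sub>R V i y" for j y
  have WU: "W \<subseteq> U" and gW: "\<And>y. y \<in> W \<Longrightarrow> g y \<noteq> 0" and xW: "x \<in> W"
    using x i by (auto simp: W_def g_def)
  have W: "openin (mtop M) W"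
    unfolding W_def g_def using U \<theta> V[OF i(1)]
    by (intro openin_smooth_function_nonzero[OF mf] smooth_function_on_pairing[OF mf])
  have \<theta>W: "smooth_one_form_on M W \<theta>" and VW: "\<And>j. j \<in> A \<Longrightarrow> smooth_vector_field_on M W (V j)"
    using \<theta> V WU by (blast intro: smooth_one_form_on_subset smooth_vector_field_on_subset)+
  have "smooth_function_on M W (f j)" if "j \<in> A" for j
    unfolding f_def using \<theta>W VW[OF that] VW[OF i(1)] gW W
    by (intro smooth_function_on_neg_quotient[OF mf])
      (auto simp: g_def intro: smooth_function_on_pairing[OF mf])
  then have V'_smooth: "smooth_vector_field_on M W (V' j)" if "j \<in> A" for j
    unfolding V'_def using that i VW W
    by (intro smooth_vector_field_on_add_scaleR[OF mf]) auto
  \<comment> \<open>A combination of the new members is one of the old members with an extra,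
    determined coefficient at \<open>i\<close>. Independence and span are thereby read off from the
    old frame.\<close>
  have V'_sum: "(\<Sum>j\<in>A - {i}. c j *\<^sub>R V' j y)
      = (\<Sum>j\<in>A. (if j = i then \<Sum>j\<in>A - {i}. c j * f j y else c j) *\<^sub>R V j y)" for c y
  proof -
    have "(\<Sum>j\<in>A. (if j = i then \<Sum>j\<in>A - {i}. c j * f j y else c j) *\<^sub>R V j y)
        = (\<Sum>j\<in>A - {i}. c j * f j y) *\<^sub>R V i y + (\<Sum>j\<in>A - {i}. c j *\<^sub>R V j y)"
      by (subst sum.remove[OF fin i(1)]) (auto intro: sum.cong)
    also have "\<dots> = (\<Sum>j\<in>A - {i}. c j *\<^sub>R V' j y)"
      by (simp add: V'_def scaleR_add_right sum.distrib scaleR_sum_left)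
    finally show ?thesis by simp
  qed
  have "local_frame M W (A - {i}) V' (\<lambda>y. {v \<in> D y. \<theta> y v = 0})"
    unfolding local_frame_def
  proof (intro conjI ballI allI impI)
    fix y assume "y \<in> W"
    then have y: "y \<in> U" and gy: "g y \<noteq> 0"
      using WU gW by auto
    show "c j = 0" if "(\<Sum>j\<in>A - {i}. c j *\<^sub>R V' j y) = 0" "j \<in> A - {i}" for c j
      using ind[OF y that(1)[unfolded V'_sum]] that(2) by auto
    have \<theta>V': "\<theta> y (V' j y) = 0" for j
      using gy by (simp add: V'_def f_def g_def linear_diff[OF lin[OF y]] linear_cmul[OF lin[OF y]])
    show "{v \<in> D y. \<theta> y v = 0} = range (\<lambda>c. \<Sum>j\<in>A - {i}. c j *\<^sub>R V' j y)" (is "?L = ?R")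
    proof
      show "?R \<subseteq> ?L"
      proof clarify
        fix c
        have "(\<Sum>j\<in>A - {i}. c j *\<^sub>R V' j y) \<in> D y"
          unfolding V'_sum D[OF y] by (rule rangeI)
        moreover have "\<theta> y (\<Sum>j\<in>A - {i}. c j *\<^sub>R V' j y) = 0"
          by (simp add: linear_sum[OF lin[OF y]] linear_cmul[OF lin[OF y]] \<theta>V')
        ultimately show "(\<Sum>j\<in>A - {i}. c j *\<^sub>R V' j y) \<in> D y \<and>
            \<theta> y (\<Sum>j\<in>A - {i}. c j *\<^sub>R V' j y) = 0" ..
      qed
      show "?L \<subseteq> ?R"
      proof clarify
        fix v assume "v \<in> D y" "\<theta> y v = 0"
        then obtain c where v: "v = (\<Sum>j\<in>A. c j *\<^sub>R V j y)" and "(\<Sum>j\<in>A. c j * \<theta> y (V j y)) = 0"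
          using D[OF y] \<theta>_sum[OF y] by auto
        \<comment> \<open>Vanishing of \<theta> on \<open>v\<close> solves for \<open>c i\<close> in
          terms of the other coefficients, which yields exactly the determined one.\<close>
        then have "c i * g y + (\<Sum>j\<in>A - {i}. c j * \<theta> y (V j y)) = 0"
          using sum.remove[OF fin i(1), of "\<lambda>j. c j * \<theta> y (V j y)"] by (simp add: g_def)
        then have "c i * g y = - (\<Sum>j\<in>A - {i}. c j * \<theta> y (V j y))"
          by linarith
        then have "c i = - (\<Sum>j\<in>A - {i}. c j * \<theta> y (V j y)) / g y"
          by (simp only: nonzero_eq_divide_eq[OF gy])
        also have "\<dots> = (\<Sum>j\<in>A - {i}. c j * f j y)"
          by (simp add: f_def sum_negf sum_divide_distrib)
        finally have "v = (\<Sum>j\<in>A - {i}. c j *\<^sub>R V' j y)"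
          unfolding V'_sum v by (intro sum.cong) auto
        then show "v \<in> ?R" by blast
      qed
    qed
  qed (use W fin V'_smooth in auto)
  with WU xW i(1) show ?thesis by (rule that)
qed

text \<open>For sections \<open>V\<close>, \<open>V'\<close> of \<open>D\<close> with values \<open>v\<close>, \<open>u\<close> at \<open>x\<close>, Cartan's formula gives
  \<open>d\<theta>(u, v) = - \<theta>([V', V])\<close>, which depends only on the value of \<open>\<theta>\<close> at \<open>x\<close>. The vector \<open>B u\<close> is
  the derivative of \<open>V\<close> in the direction \<open>u\<close>, in the chart at \<open>x\<close>.\<close>

lemma derivative_annihilator:
  assumes F: "local_frame M U A V D" and x: "x \<in> U" and v: "v \<in> D x"
  obtains B where "\<And>\<theta> u. smooth_one_form_on M U \<theta> \<Longrightarrow> (\<And>y w. y \<in> U \<Longrightarrow> w \<in> D y \<Longrightarrow> \<theta> y w = 0) \<Longrightarrow>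
    frechet_derivative (form_coord M (chart_at M x) \<theta> v) (at (cmap (chart_at M x) x)) u = - \<theta> x (B u)"
proof -
  have U: "openin (mtop M) U" and fin: "finite A"
    and V: "\<And>i. i \<in> A \<Longrightarrow> smooth_vector_field_on M U (V i)"
    and D: "\<And>y. y \<in> U \<Longrightarrow> D y = range (\<lambda>c. \<Sum>i\<in>A. c i *\<^sub>R V i y)"
    using F by (auto simp: local_frame_def)
  have xM: "x \<in> carrier M"
    using U x openin_subset unfolding carrier_def by blast
  define c where "c = chart_at M x"
  define z0 where "z0 = cmap c x"
  have c: "c \<in> atlas M" and xc: "x \<in> cdom c"
    using chart_at[OF mf xM] by (auto simp: c_def)
  have inv: "cinv c (cmap c y) = y" if "y \<in> cdom c" for y
    using cinv_cmap[OF atlas_chart_of[OF mf c] that] .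
  define S where "S = cmap c ` (U \<inter> cdom c)"
  have S: "open S" and z0: "z0 \<in> S"
    using open_cmap_image[OF atlas_chart_of[OF mf c] U] x xc by (auto simp: S_def z0_def)
  obtain a where a: "v = (\<Sum>i\<in>A. a i *\<^sub>R V i x)"
    using v D[OF x] by auto
  \<comment> \<open>Freezing the coefficients \<open>a\<close> of \<open>v\<close> at
    \<open>x\<close> extends \<open>v\<close> to a section of \<open>D\<close>, here in the
    coordinates of \<open>c\<close>. Its derivative will be \<open>B\<close>; it is fixed before
    \<theta> is.\<close>
  define s where "s z = (\<Sum>i\<in>A. a i *\<^sub>R tcoord M c (cinv c z) (V i (cinv c z)))" for z
  have "smooth_on S s"
    unfolding s_def using V c S
    by (intro smooth_on_sum smooth_on_scaleR smooth_on_const)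
      (auto simp: S_def smooth_vector_field_on_def)
  then have ds: "(s has_derivative frechet_derivative s (at z0)) (at z0)"
    using z0 smooth_on_differentiable frechet_derivative_works by blast
  have s0: "s z0 = v"
    unfolding s_def z0_def inv[OF xc] a unfolding c_def tcoord_chart_at[OF mf xM] ..
  show ?thesis
  proof (rule that, unfold c_def[symmetric] z0_def[symmetric])
    fix \<theta> u assume \<theta>: "smooth_one_form_on M U \<theta>" and van: "\<And>y w. y \<in> U \<Longrightarrow> w \<in> D y \<Longrightarrow> \<theta> y w = 0"
    have lin: "linear (\<theta> y)" if "y \<in> U" for y
      using \<theta> that by (simp add: smooth_one_form_on_def)
    let ?F = "\<lambda>w. form_coord M c \<theta> w"
    have dF: "(?F w has_derivative frechet_derivative (?F w) (at z0)) (at z0)" for w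
    proof -
      have "smooth_on S (?F w)"
        using \<theta> c by (simp add: smooth_one_form_on_def S_def)
      then show ?thesis
        using z0 smooth_on_differentiable frechet_derivative_works by blast
    qed
    have exp: "(\<Sum>b\<in>Basis. (w \<bullet> b) *\<^sub>R ?F b z) = \<theta> (cinv c z) (tvec M c (cinv c z) w)" if z: "z \<in> S" for z w
    proof -
      obtain y where "y \<in> U" "y \<in> cdom c" "z = cmap c y" using z unfolding S_def by blast
      then show ?thesis
        using form_coord_expansion[OF mf, of \<theta> y c w, OF lin c] by (simp only: inv)
    qed
    \<comment> \<open>The pairing of \<theta> with a section of \<open>D\<close> vanishes
      identically, hence so does its derivative at \<open>z0\<close>; the Leibniz rule then trades
      derivatives of \<theta> for the derivative of \<open>s\<close>.\<close>
    have zero: "(\<Sum>b\<in>Basis. (s z \<bullet> b) *\<^sub>R ?F b z) = 0" if z: "z \<in> S" for z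
    proof -
      obtain y where y: "y \<in> U" "y \<in> cdom c" "z = cmap c y" using z unfolding S_def by blast
      have "tvec M c y (s z) = (\<Sum>i\<in>A. a i *\<^sub>R V i y)"
        using linear_tvec[OF mf c y(2)] y
        by (simp add: s_def inv linear_sum linear_cmul tvec_tcoord[OF mf c])
      then have "tvec M c y (s z) \<in> D y"
        using D[OF y(1)] by blast
      then show ?thesis
        using van y exp[OF z, of "s z"] by (simp add: inv)
    qed
    have "((\<lambda>z. \<Sum>b\<in>Basis. (s z \<bullet> b) *\<^sub>R ?F b z) has_derivative (\<lambda>h. \<Sum>b\<in>Basis.
        (s z0 \<bullet> b) *\<^sub>R frechet_derivative (?F b) (at z0) h
        + (frechet_derivative s (at z0) h \<bullet> b) *\<^sub>R ?F b z0)) (at z0)"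
      by (intro has_derivative_sum has_derivative_scaleR has_derivative_inner_left ds dF)
    moreover have "((\<lambda>z. \<Sum>b\<in>Basis. (s z \<bullet> b) *\<^sub>R ?F b z) has_derivative (\<lambda>h. 0)) (at z0)"
      by (rule has_derivative_transform_within_open[OF has_derivative_const S z0, of 0]) (simp only: zero)
    ultimately have "(\<lambda>h. \<Sum>b\<in>Basis. (s z0 \<bullet> b) *\<^sub>R frechet_derivative (?F b) (at z0) h
        + (frechet_derivative s (at z0) h \<bullet> b) *\<^sub>R ?F b z0) = (\<lambda>h. 0)"
      by (rule has_derivative_unique)
    from fun_cong[OF this, of u]
    have "(\<Sum>b\<in>Basis. (v \<bullet> b) *\<^sub>R frechet_derivative (?F b) (at z0) u)
        = - (\<Sum>b\<in>Basis. (frechet_derivative s (at z0) u \<bullet> b) *\<^sub>R ?F b z0)"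
      unfolding sum.distrib s0 by (simp only: eq_neg_iff_add_eq_0)
    moreover have "(\<Sum>b\<in>Basis. (w \<bullet> b) *\<^sub>R ?F b z0) = \<theta> x w" for w
      unfolding exp[OF z0] unfolding z0_def inv[OF xc] by (simp add: c_def tvec_chart_at[OF mf xM])
    \<comment> \<open>Here \<open>v\<close> stays constant in the chart, so only the components of
      \<theta> get differentiated, unlike for the varying \<open>s\<close>.\<close>
    moreover have "frechet_derivative (?F v) (at z0) u
        = (\<Sum>b\<in>Basis. (v \<bullet> b) *\<^sub>R frechet_derivative (?F b) (at z0) u)"
    proof -
      have "((\<lambda>z. \<Sum>b\<in>Basis. (v \<bullet> b) *\<^sub>R ?F b z) has_derivative
          (\<lambda>h. \<Sum>b\<in>Basis. (v \<bullet> b) *\<^sub>R frechet_derivative (?F b) (at z0) h)) (at z0)"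
        by (intro has_derivative_sum has_derivative_scaleR_right dF)
      then have "(?F v has_derivative
          (\<lambda>h. \<Sum>b\<in>Basis. (v \<bullet> b) *\<^sub>R frechet_derivative (?F b) (at z0) h)) (at z0)"
        by (rule has_derivative_transform_within_open[OF _ S z0]) (simp only: exp form_coord_def[of _ _ _ v])
      from has_derivative_unique[OF dF[of v] this] show ?thesis
        by (rule fun_cong)
    qed
    ultimately show "frechet_derivative (?F v) (at z0) u = - \<theta> x (frechet_derivative s (at z0) u)"
      by (simp only:)
  qed
qed

text \<open>\<open>B\<close> depends on the section but not on the form. Each of the two terms of
  the exterior derivative is therefore the same linear expression in the value of the form at
  \<open>x\<close>, and scales with it.\<close>

lemma ext_deriv_annihilator:
  assumes F: "local_frame M U A V D" and x: "x \<in> U"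
    and \<theta>: "smooth_one_form_on M U \<theta>" "\<And>y w. y \<in> U \<Longrightarrow> w \<in> D y \<Longrightarrow> \<theta> y w = 0"
    and \<eta>: "smooth_one_form_on M U \<eta>" "\<And>y w. y \<in> U \<Longrightarrow> w \<in> D y \<Longrightarrow> \<eta> y w = 0"
    and eq: "\<And>w. \<theta> x w = s * \<eta> x w"
    and uv: "u \<in> D x" "v \<in> D x"
  shows "ext_deriv M \<theta> x u v = s * ext_deriv M \<eta> x u v"
proof -
  have "frechet_derivative (form_coord M (chart_at M x) \<theta> w) (at (cmap (chart_at M x) x)) h
      = s * frechet_derivative (form_coord M (chart_at M x) \<eta> w) (at (cmap (chart_at M x) x)) h"
    if w: "w \<in> D x" for w h
  proof -
    obtain B where B: "\<And>\<theta> u. smooth_one_form_on M U \<theta> \<Longrightarrow>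
        (\<And>y w. y \<in> U \<Longrightarrow> w \<in> D y \<Longrightarrow> \<theta> y w = 0) \<Longrightarrow>
        frechet_derivative (form_coord M (chart_at M x) \<theta> w) (at (cmap (chart_at M x) x)) u
          = - \<theta> x (B u)"
      using derivative_annihilator[OF F x w] by blast
    have "frechet_derivative (form_coord M (chart_at M x) \<theta> w) (at (cmap (chart_at M x) x)) h = - \<theta> x (B h)"
      by (rule B) (fact \<theta>)+
    moreover have "frechet_derivative (form_coord M (chart_at M x) \<eta> w) (at (cmap (chart_at M x) x)) h = - \<eta> x (B h)"
      by (rule B) (fact \<eta>)+
    ultimately show ?thesis
      unfolding eq by simp
  qed
  then show ?thesis
    using uv by (simp add: ext_deriv_def Let_def right_diff_distrib)
qed

end

section \<open>Quaternionic linear algebra of a hyperplane\<close>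

text \<open>If \<open>f u\<close> is nonzero, subtracting (f v / f u) u moves \<open>v\<close> into
  the kernel of \<open>f\<close>, giving the constant g u / f u; if \<open>f\<close> vanishes on
  \<open>S\<close>, so does \<open>g\<close>, and 0 serves. The relative form over \<open>S\<close>
  allows several functionals to be peeled off one at a time.\<close>

lemma linear_functional_factor:
  fixes f g :: "'a::real_vector \<Rightarrow> real"
  assumes f: "linear f" and g: "linear g" and S: "subspace S"
    and vanish: "\<And>v. v \<in> S \<Longrightarrow> f v = 0 \<Longrightarrow> g v = 0"
  obtains c where "\<And>v. v \<in> S \<Longrightarrow> g v = c * f v"
proof (cases "\<exists>u\<in>S. f u \<noteq> 0")
  case True
  then obtain u where u: "u \<in> S" "f u \<noteq> 0" by auto
  have "g v = (g u / f u) * f v" if v: "v \<in> S" for v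
  proof -
    have "v - (f v / f u) *\<^sub>R u \<in> S"
      using S u v by (simp add: subspace_diff subspace_scale)
    moreover have "f (v - (f v / f u) *\<^sub>R u) = 0"
      using u by (simp add: linear_diff[OF f] linear_cmul[OF f])
    ultimately have "g (v - (f v / f u) *\<^sub>R u) = 0"
      by (rule vanish)
    then show ?thesis
      by (simp add: linear_diff[OF g] linear_cmul[OF g] mult.commute)
  qed
  then show ?thesis by (rule that)
next
  case False
  then show ?thesis
    using vanish by (intro that[of 0]) auto
qed

text \<open>The situation in one tangent space: \<iota> is the differential of the inclusion and
  \<open>n\<close> a normal of its image for the Euclidean product of the coordinates, which need
  not be invariant under \<open>I\<close>, \<open>J\<close>, \<open>K\<close>.\<close>

locale quaternionic_hyperplane =
  fixes \<iota> :: "'f::euclidean_space \<Rightarrow> 'e::euclidean_space"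
    and n :: 'e and I J K :: "'e \<Rightarrow> 'e"
  assumes \<iota>: "linear \<iota>" "inj \<iota>"
    and n: "n \<noteq> 0" "range \<iota> = {v. n \<bullet> v = 0}"
    and lin: "linear I" "linear J" "linear K"
    and sq: "I (I v) = - v" "J (J v) = - v" "K (K v) = - v"
    and IJ: "I (J v) = K v" and JI: "J (I v) = - K v"
begin

lemma mult_table: "I (K v) = - J v" "K (I v) = J v" "J (K v) = I v" "K (J v) = - I v"
proof -
  show IK: "I (K v) = - J v"
    by (simp add: sq flip: IJ)
  have "K (I v) = I (J (I v))"
    by (simp add: IJ)
  then show "K (I v) = J v"
    by (simp add: JI linear_neg[OF lin(1)] IK)
  have "I (J (K v)) = - v"
    by (simp add: IJ sq)
  then have "I (I (J (K v))) = - I v"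
    by (simp add: linear_neg[OF lin(1)])
  then show "J (K v) = I v"
    by (simp add: sq)
  show "K (J v) = - I v"
    using IJ[of "J v"] by (simp add: sq linear_neg[OF lin(1)])
qed

definition comb :: "real \<Rightarrow> real \<Rightarrow> real \<Rightarrow> 'e \<Rightarrow> 'e" where
  "comb a b c v = a *\<^sub>R I v + b *\<^sub>R J v + c *\<^sub>R K v"

lemma linear_comb: "linear (comb a b c)"
  unfolding comb_def by (intro linear_compose_add linear_compose_scale_right lin)

text \<open>Mixed products cancel by anticommutation, leaving minus the sum of squares.\<close>

lemma comb_comb:
  assumes "a\<^sup>2 + b\<^sup>2 + c\<^sup>2 = 1"
  shows "comb a b c (comb a b c v) = - v"
proof -
  have "comb a b c (comb a b c v) = - ((a\<^sup>2 + b\<^sup>2 + c\<^sup>2) *\<^sub>R v)"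
    unfolding comb_def
    by (simp add: linear_add[OF lin(1)] linear_add[OF lin(2)] linear_add[OF lin(3)]
        linear_cmul[OF lin(1)] linear_cmul[OF lin(2)] linear_cmul[OF lin(3)]
        sq IJ JI mult_table algebra_simps power2_eq_square)
  then show ?thesis
    by (simp add: assms)
qed

section \<open>CR spaces and conormals of the hyperplane\<close>

definition cr :: "real \<Rightarrow> real \<Rightarrow> real \<Rightarrow> 'f set" where
  "cr a b c = {v. \<iota> v \<in> comb a b c ` range \<iota>}"

text \<open>This functional cuts out the tangent vectors that \<open>comb a b c\<close> keeps
  tangent. It is linear in \<open>a\<close>, \<open>b\<close>, \<open>c\<close>, which reduces
  questions about all the CR spaces to three functionals.\<close>

definition conormal :: "real \<Rightarrow> real \<Rightarrow> real \<Rightarrow> 'f \<Rightarrow> real" where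
  "conormal a b c v = n \<bullet> comb a b c (\<iota> v)"

lemma linear_conormal: "linear (conormal a b c)"
proof -
  have "linear ((\<bullet>) n \<circ> (comb a b c \<circ> \<iota>))"
    by (intro linear_compose \<iota> linear_comb bounded_linear.linear bounded_linear_inner_right)
  then show ?thesis
    by (simp add: conormal_def[abs_def] o_def)
qed

lemma conormal_expand: "conormal a b c v = a * conormal 1 0 0 v + b * conormal 0 1 0 v + c * conormal 0 0 1 v"
  by (simp add: conormal_def comb_def inner_add_right)

text \<open>As \<open>comb a b c\<close> squares to -1, a vector lies in the image of the hyperplane
  exactly if \<open>comb a b c\<close> maps it into the hyperplane, that is, orthogonally to
  \<open>n\<close>.\<close>

lemma mem_cr:
  assumes "a\<^sup>2 + b\<^sup>2 + c\<^sup>2 = 1"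
  shows "v \<in> cr a b c \<longleftrightarrow> conormal a b c v = 0"
proof -
  have "\<iota> v \<in> comb a b c ` range \<iota> \<longleftrightarrow> comb a b c (\<iota> v) \<in> range \<iota>"
  proof
    assume "\<iota> v \<in> comb a b c ` range \<iota>"
    then obtain w where "\<iota> v = comb a b c (\<iota> w)" by auto
    then have "comb a b c (\<iota> v) = \<iota> (- w)"
      by (simp add: comb_comb[OF assms] linear_neg[OF \<iota>(1)])
    then show "comb a b c (\<iota> v) \<in> range \<iota>" by (rule range_eqI)
  next
    assume "comb a b c (\<iota> v) \<in> range \<iota>"
    then obtain w where "comb a b c (\<iota> v) = \<iota> w" by auto
    then have "comb a b c (\<iota> w) = - \<iota> v"
      using comb_comb[OF assms] by metis
    then have "\<iota> v = comb a b c (\<iota> (- w))"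
      by (simp add: linear_neg[OF \<iota>(1)] linear_neg[OF linear_comb])
    then show "\<iota> v \<in> comb a b c ` range \<iota>" by blast
  qed
  then show ?thesis
    using n(2) by (simp add: cr_def conormal_def)
qed

text \<open>Otherwise L = \<open>comb a b c\<close> would preserve the hyperplane and act on the
  one-dimensional quotient by a real number with square -1. That number is \<open>t\<close>, since L
  n differs from t n by a vector of the hyperplane.\<close>

lemma conormal_nonzero:
  assumes "a\<^sup>2 + b\<^sup>2 + c\<^sup>2 = 1"
  shows "\<exists>v. conormal a b c v \<noteq> 0"
proof (rule ccontr)
  assume "\<nexists>v. conormal a b c v \<noteq> 0"
  then have inv: "n \<bullet> comb a b c w = 0" if "n \<bullet> w = 0" for w
  proof -
    have "w \<in> range \<iota>"
      using that n(2) by simp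
    then show ?thesis
      using \<open>\<nexists>v. conormal a b c v \<noteq> 0\<close> by (auto simp: conormal_def)
  qed
  let ?m = "comb a b c n"
  define t where "t = (n \<bullet> ?m) / (n \<bullet> n)"
  have nn: "n \<bullet> n > 0"
    using n(1) by simp
  have "n \<bullet> (?m - t *\<^sub>R n) = 0"
    using nn by (simp add: t_def inner_diff_right)
  then have "n \<bullet> comb a b c (?m - t *\<^sub>R n) = 0"
    by (rule inv)
  then have "- (n \<bullet> n) = t * (n \<bullet> ?m)"
    by (simp add: linear_diff[OF linear_comb] linear_cmul[OF linear_comb] comb_comb[OF assms]
        inner_diff_right)
  also have "\<dots> = t\<^sup>2 * (n \<bullet> n)"
    using nn by (simp add: t_def power2_eq_square)
  finally show False
    using nn by (smt (verit) zero_le_mult_iff zero_le_power2)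
qed

lemma normalize_coefficients:
  fixes a b c :: real
  assumes "a \<noteq> 0 \<or> b \<noteq> 0 \<or> c \<noteq> 0"
  obtains r a' b' c' where "r \<noteq> 0" "a'\<^sup>2 + b'\<^sup>2 + c'\<^sup>2 = 1"
    "\<And>v. conormal a b c v = r * conormal a' b' c' v"
proof
  let ?r = "sqrt (a\<^sup>2 + b\<^sup>2 + c\<^sup>2)"
  have pos: "a\<^sup>2 + b\<^sup>2 + c\<^sup>2 > 0"
    using assms by (smt (verit) zero_less_power2 zero_le_power2)
  then show r: "?r \<noteq> 0" by simp
  show "(a / ?r)\<^sup>2 + (b / ?r)\<^sup>2 + (c / ?r)\<^sup>2 = 1"
    using pos by (simp add: power_divide add_divide_distrib[symmetric])
  show "conormal a b c v = ?r * conormal (a / ?r) (b / ?r) (c / ?r) v" for v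
    unfolding conormal_expand[of a] conormal_expand[of "a / ?r"] using r
    by (simp add: distrib_left)
qed

text \<open>By \<open>conormal_expand\<close> this is linear independence of the conormals of
  \<open>I\<close>, \<open>J\<close>, \<open>K\<close>: a nontrivial relation would rescale to a
  unit triple with zero conormal.\<close>

lemma conormal_independent:
  assumes "\<And>v. conormal a b c v = 0"
  shows "a = 0 \<and> b = 0 \<and> c = 0"
proof (rule ccontr)
  assume "\<not> ?thesis"
  then obtain r a' b' c' where "r \<noteq> 0" "a'\<^sup>2 + b'\<^sup>2 + c'\<^sup>2 = 1"
    "\<And>v. conormal a b c v = r * conormal a' b' c' v"
    using normalize_coefficients by metis
  then show False
    using conormal_nonzero[of a' b' c'] assms by auto
qed

section \<open>The largest quaternionic subspace of the hyperplane\<close>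

abbreviation invariant_core :: "'f set" where
  "invariant_core \<equiv> cr 1 0 0 \<inter> cr 0 1 0 \<inter> cr 0 0 1"

lemma mem_core:
  "v \<in> invariant_core \<longleftrightarrow> conormal 1 0 0 v = 0 \<and> conormal 0 1 0 v = 0 \<and> conormal 0 0 1 v = 0"
  by (simp add: mem_cr)

lemma subspace_core: "subspace invariant_core"
proof -
  have "invariant_core = {v. conormal 1 0 0 v = 0} \<inter> {v. conormal 0 1 0 v = 0} \<inter> {v. conormal 0 0 1 v = 0}"
    using mem_core by auto
  then show ?thesis
    by (simp add: subspace_inter linear_subspace_kernel linear_conormal)
qed

text \<open>The vector \<iota> v and its images under \<open>I\<close>, \<open>J\<close>,
  \<open>K\<close> span a quaternionic subspace orthogonal to \<open>n\<close>. Applying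
  \<open>I\<close>, \<open>J\<close> or \<open>K\<close> to \<open>comb a b c (\<iota> v)\<close>
  stays in this span, so the preimage \<open>w\<close> again satisfies all three equations.\<close>

lemma core_invariant:
  assumes v: "v \<in> invariant_core"
  obtains w where "w \<in> invariant_core" "comb a b c (\<iota> v) = \<iota> w"
proof -
  have \<iota>v: "n \<bullet> \<iota> v = 0"
    using n(2) by auto
  have 0: "n \<bullet> I (\<iota> v) = 0" "n \<bullet> J (\<iota> v) = 0" "n \<bullet> K (\<iota> v) = 0"
    using v unfolding mem_core by (simp_all add: conormal_def comb_def)
  then have "comb a b c (\<iota> v) \<in> range \<iota>"
    unfolding n(2) by (simp add: comb_def inner_add_right)
  then obtain w where w: "comb a b c (\<iota> v) = \<iota> w" by auto
  have "n \<bullet> I (\<iota> w) = 0" "n \<bullet> J (\<iota> w) = 0" "n \<bullet> K (\<iota> w) = 0"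
    unfolding w[symmetric] comb_def
    by (simp_all add: linear_add[OF lin(1)] linear_add[OF lin(2)] linear_add[OF lin(3)]
        linear_cmul[OF lin(1)] linear_cmul[OF lin(2)] linear_cmul[OF lin(3)]
        sq IJ JI mult_table inner_add_right inner_diff_right 0 \<iota>v)
  then have "w \<in> invariant_core"
    unfolding mem_core by (simp add: conormal_def comb_def)
  then show ?thesis
    using w by (rule that)
qed

lemma core_subset_cr: "a\<^sup>2 + b\<^sup>2 + c\<^sup>2 = 1 \<Longrightarrow> invariant_core \<subseteq> cr a b c"
  by (auto simp: mem_cr conormal_expand[of a])

text \<open>\<open>GREATEST\<close> refers to inclusion, so a maximum has to be exhibited. The core
  is invariant by \<open>core_invariant\<close>, and it contains every invariant \<open>S\<close>
  because \<open>I\<close>, \<open>J\<close>, \<open>K\<close> keep the vectors of \<open>S\<close>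
  tangent.\<close>

lemma Greatest_invariant_subspace:
  "(GREATEST S. subspace S \<and> I ` \<iota> ` S \<subseteq> \<iota> ` S \<and> J ` \<iota> ` S \<subseteq> \<iota> ` S \<and> K ` \<iota> ` S \<subseteq> \<iota> ` S)
    = invariant_core"
proof (rule Greatest_equality, intro conjI subspace_core)
  have sub: "comb a b c ` \<iota> ` invariant_core \<subseteq> \<iota> ` invariant_core" for a b c
  proof clarify
    fix v assume "v \<in> cr 1 0 0" "v \<in> cr 0 1 0" "v \<in> cr 0 0 1"
    then have "v \<in> invariant_core" by simp
    then obtain w where "w \<in> invariant_core" "comb a b c (\<iota> v) = \<iota> w"
      by (rule core_invariant)
    then show "comb a b c (\<iota> v) \<in> \<iota> ` invariant_core" by simp
  qed
  show "I ` \<iota> ` invariant_core \<subseteq> \<iota> ` invariant_core"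
    using sub[of 1 0 0] by (simp add: comb_def)
  show "J ` \<iota> ` invariant_core \<subseteq> \<iota> ` invariant_core"
    using sub[of 0 1 0] by (simp add: comb_def)
  show "K ` \<iota> ` invariant_core \<subseteq> \<iota> ` invariant_core"
    using sub[of 0 0 1] by (simp add: comb_def)
next
  fix S assume S: "subspace S \<and> I ` \<iota> ` S \<subseteq> \<iota> ` S \<and> J ` \<iota> ` S \<subseteq> \<iota> ` S \<and> K ` \<iota> ` S \<subseteq> \<iota> ` S"
  show "S \<subseteq> invariant_core"
  proof
    fix v assume "v \<in> S"
    then have "I (\<iota> v) \<in> range \<iota>" "J (\<iota> v) \<in> range \<iota>" "K (\<iota> v) \<in> range \<iota>"
      using S by blast+
    then show "v \<in> invariant_core"
      unfolding n(2) mem_core by (simp add: conormal_def comb_def)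
  qed
qed

text \<open>These are the vectors off the kernel that three successive eliminations require. A
  missing one would make a conormal a combination of the preceding ones by
  \<open>linear_functional_factor\<close>, against independence.\<close>

lemma cr_independent:
  shows "\<exists>v. v \<notin> cr 1 0 0"
    and "\<exists>v. v \<in> cr 1 0 0 \<and> v \<notin> cr 0 1 0"
    and "\<exists>v. v \<in> cr 1 0 0 \<and> v \<in> cr 0 1 0 \<and> v \<notin> cr 0 0 1"
proof -
  note l = linear_conormal
  show "\<exists>v. v \<notin> cr 1 0 0"
    using conormal_nonzero[of 1 0 0] by (simp add: mem_cr)
  show "\<exists>v. v \<in> cr 1 0 0 \<and> v \<notin> cr 0 1 0"
  proof (rule ccontr)
    assume "\<not> ?thesis"
    then obtain s where "\<And>v. conormal 0 1 0 v = s * conormal 1 0 0 v"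
      using linear_functional_factor[OF l l subspace_UNIV, of 1 0 0 0 1 0] by (auto simp: mem_cr)
    then have "conormal s (-1) 0 v = 0" for v
      by (simp add: conormal_expand[of s])
    then show False
      using conormal_independent[of s "-1" 0] by simp
  qed
  show "\<exists>v. v \<in> cr 1 0 0 \<and> v \<in> cr 0 1 0 \<and> v \<notin> cr 0 0 1"
  proof (rule ccontr)
    assume *: "\<not> ?thesis"
    \<comment> \<open>The dependence is found in two stages: first on the kernel of the first
      conormal, then on the whole space.\<close>
    obtain s where s: "\<And>v. v \<in> {v. conormal 1 0 0 v = 0} \<Longrightarrow> conormal 0 0 1 v = s * conormal 0 1 0 v"
      by (rule linear_functional_factor[OF l l linear_subspace_kernel[OF l], of 1 0 0 0 1 0 0 0 1])
        (use * in \<open>auto simp: mem_cr\<close>)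
    obtain t where t: "\<And>v. conormal 0 (-s) 1 v = t * conormal 1 0 0 v"
      by (rule linear_functional_factor[OF l l subspace_UNIV, of 1 0 0 0 "-s" 1])
        (use s in \<open>auto simp: conormal_expand[of 0 "-s"]\<close>)
    have "conormal (-t) (-s) 1 v = 0" for v
      using t[of v] unfolding conormal_expand[of 0 "-s"] conormal_expand[of "-t"] by simp
    then show False
      using conormal_independent[of "-t" "-s" 1] by simp
  qed
qed

text \<open>Factoring on the common kernel of two conormals, then on the kernel of one, then
  everywhere, expresses \<open>g\<close> as a combination of all three. As \<open>g\<close> is
  nonzero, the triple can be rescaled to a unit one without changing the kernel.\<close>

lemma functional_vanishing_on_core:
  fixes g :: "'f \<Rightarrow> real"
  assumes g: "linear g" and vanish: "\<And>v. v \<in> invariant_core \<Longrightarrow> g v = 0" and "g u \<noteq> 0"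
  obtains a b c where "a\<^sup>2 + b\<^sup>2 + c\<^sup>2 = 1" "{v. g v = 0} = cr a b c"
proof -
  note l = linear_conormal
  let ?S = "{v. conormal 1 0 0 v = 0}"
  have S: "subspace ?S" "subspace (?S \<inter> {v. conormal 0 1 0 v = 0})"
    by (simp_all add: subspace_inter linear_subspace_kernel l)
  obtain c where c: "\<And>v. v \<in> ?S \<inter> {v. conormal 0 1 0 v = 0} \<Longrightarrow> g v = c * conormal 0 0 1 v"
    by (rule linear_functional_factor[OF l g S(2), of 0 0 1]) (use vanish in \<open>auto simp: mem_cr\<close>)
  have g1: "linear (\<lambda>v. g v - c * conormal 0 0 1 v)"
    using linear_compose_sub[OF g linear_compose_scale_right[OF l, of c 0 0 1]] by simp
  obtain b where b: "\<And>v. v \<in> ?S \<Longrightarrow> g v - c * conormal 0 0 1 v = b * conormal 0 1 0 v"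
    by (rule linear_functional_factor[OF l g1 S(1), of 0 1 0]) (use c in auto)
  have g2: "linear (\<lambda>v. g v - c * conormal 0 0 1 v - b * conormal 0 1 0 v)"
    using linear_compose_sub[OF g1 linear_compose_scale_right[OF l, of b 0 1 0]] by simp
  obtain a where a: "\<And>v. v \<in> UNIV \<Longrightarrow> g v - c * conormal 0 0 1 v - b * conormal 0 1 0 v = a * conormal 1 0 0 v"
    by (rule linear_functional_factor[OF l g2 subspace_UNIV, of 1 0 0]) (use b in auto)
  have eq: "g v = conormal a b c v" for v
    using a[of v] by (simp add: conormal_expand[of a])
  then have "a \<noteq> 0 \<or> b \<noteq> 0 \<or> c \<noteq> 0"
    using \<open>g u \<noteq> 0\<close> by (auto simp: conormal_expand[of a])
  then obtain r a' b' c' where r: "r \<noteq> 0" "a'\<^sup>2 + b'\<^sup>2 + c'\<^sup>2 = 1"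
    "\<And>v. conormal a b c v = r * conormal a' b' c' v"
    using normalize_coefficients by metis
  show ?thesis
    using r by (intro that[of a' b' c']) (auto simp: eq mem_cr)
qed

end

section \<open>The quaternionic distribution of a hypersurface\<close>

text \<open>A change of index set: an enumeration of \<open>A\<close> gives the initial segment of
  the naturals that \<open>smooth_distribution\<close> asks for.\<close>

lemma local_frame_imp_smooth_distribution:
  assumes "\<And>x. x \<in> carrier M \<Longrightarrow> \<exists>U (A :: 'i set) V. x \<in> U \<and> local_frame M U A V D"
  shows "smooth_distribution M D"
  unfolding smooth_distribution_def
proof
  fix x assume "x \<in> carrier M"
  then obtain U V and A :: "'i set" where x: "x \<in> U" and F: "local_frame M U A V D"
    using assms by blast
  from ex_bij_betw_nat_finite[OF local_frame_finite[OF F]] obtain h where h: "bij_betw h {..<card A} A"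
    unfolding atLeast0LessThan ..
  have "openin (mtop M) U" "\<forall>i<card A. smooth_vector_field_on M U (V (h i))"
    using local_frame_openin[OF F] local_frame_smooth[OF F] bij_betwE[OF h] by auto
  moreover have "inj_on (\<lambda>i. V (h i) y) {..<card A} \<and> independent ((\<lambda>i. V (h i) y) ` {..<card A})
      \<and> span ((\<lambda>i. V (h i) y) ` {..<card A}) = D y" if y: "y \<in> U" for y
  proof -
    have im: "(\<lambda>i. V (h i) y) ` {..<card A} = (\<lambda>i. V i y) ` A"
      using bij_betw_imp_surj_on[OF h] image_image[of "\<lambda>i. V i y" h "{..<card A}"] by simp
    have "inj_on ((\<lambda>i. V i y) \<circ> h) {..<card A}"
      using h inj_on_local_frame[OF F y] by (intro comp_inj_on) (auto simp: bij_betw_def)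
    then show ?thesis
      unfolding im using independent_local_frame[OF F y] span_local_frame[OF F y] by (simp add: o_def)
  qed
  ultimately show "\<exists>U k (W :: nat \<Rightarrow> _). openin (mtop M) U \<and> x \<in> U \<and>
      (\<forall>i<k. smooth_vector_field_on M U (W i)) \<and>
      (\<forall>y\<in>U. inj_on (\<lambda>i. W i y) {..<k} \<and> independent ((\<lambda>i. W i y) ` {..<k}) \<and>
              span ((\<lambda>i. W i y) ` {..<k}) = D y)"
    using x by (intro exI[of _ U] exI[of _ "card A"] exI[of _ "\<lambda>i. V (h i)"]) blast
qed

context
  fixes X :: "('x, 'e::euclidean_space) manifold"
    and M :: "('x, 'f::euclidean_space) manifold"
    and I J K :: "'x \<Rightarrow> 'e \<Rightarrow> 'e"
  assumes X: "hypercomplex_manifold X I J K" and M: "real_hypersurface M X"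
begin

text \<open>The differential of the inclusion is injective, so its image has dimension
  \<open>DIM('f)\<close>, one less than \<open>DIM('e)\<close>, and is a hyperplane.\<close>

lemma quaternionic_hyperplane_at:
  assumes x: "x \<in> carrier M"
  obtains n where "quaternionic_hyperplane (incl_deriv M X x) n (I x) (J x) (K x)"
proof -
  let ?\<iota> = "incl_deriv M X x"
  have mX: "smooth_manifold X" and mM: "smooth_manifold M" and xX: "x \<in> carrier X"
    and inj: "inj ?\<iota>" and dim: "DIM('e) = DIM('f) + 1"
    using X M x by (auto simp: hypercomplex_manifold_def real_hypersurface_def submanifold_def)
  have "smooth_on (cmap (chart_at M x) ` (cdom (chart_at M x) \<inter> cdom (chart_at X x)))
      (cmap (chart_at X x) \<circ> cinv (chart_at M x))"
    using M chart_at_atlas[OF mM x] chart_at_atlas[OF mX xX]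
    by (auto simp: real_hypersurface_def submanifold_def)
  then have "(cmap (chart_at X x) \<circ> cinv (chart_at M x)) differentiable (at (cmap (chart_at M x) x))"
    using chart_at_cdom[OF mM x] chart_at_cdom[OF mX xX] by (auto intro: smooth_on_differentiable)
  then have lin: "linear ?\<iota>"
    unfolding incl_deriv_def[abs_def] by (rule linear_frechet_derivative)
  have dim_range: "dim (range ?\<iota>) = DIM('f)"
    using dim_image_eq[OF lin, of UNIV] inj by simp
  then obtain n where n: "n \<noteq> 0" "span (range ?\<iota>) \<subseteq> {v. n \<bullet> v = 0}"
    using lowdim_subset_hyperplane[of "range ?\<iota>"] dim by auto
  have range: "range ?\<iota> = {v. n \<bullet> v = 0}"
  proof (rule subspace_dim_equal)
    show "range ?\<iota> \<subseteq> {v. n \<bullet> v = 0}"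
      using n(2) span_superset by blast
    show "dim {v. n \<bullet> v = 0} \<le> dim (range ?\<iota>)"
      using dim_hyperplane[OF n(1)] dim dim_range by simp
  qed (simp_all add: subspace_hyperplane linear_subspace_image[OF lin])
  have "I x (J x v) = K x v" "J x (I x v) = - K x v"
    "linear (I x)" "I x (I x v) = - v" "linear (J x)" "J x (J x v) = - v"
    "linear (K x)" "K x (K x v) = - v" for v
    using X xX by (simp_all add: hypercomplex_manifold_def complex_structure_def
        almost_complex_structure_def)
  then have "quaternionic_hyperplane ?\<iota> n (I x) (J x) (K x)"
    by (intro quaternionic_hyperplane.intro lin inj n(1) range) assumption+
  then show ?thesis by (rule that)
qed

abbreviation (input) "CR a b c \<equiv> cr_space M X (\<lambda>x v. a *\<^sub>R I x v + b *\<^sub>R J x v + c *\<^sub>R K x v)"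

abbreviation (input) "H \<equiv> quaternionic_distribution M X I J K"

lemma cr_space_eq:
  assumes "quaternionic_hyperplane (incl_deriv M X x) n (I x) (J x) (K x)"
  shows "CR a b c x = quaternionic_hyperplane.cr (incl_deriv M X x) (I x) (J x) (K x) a b c"
  by (simp add: quaternionic_hyperplane.cr_def[OF assms] cr_space_def
      quaternionic_hyperplane.comb_def[OF assms, abs_def])

lemma quaternionic_distribution_eq:
  assumes "x \<in> carrier M"
  shows "H x = CR 1 0 0 x \<inter> CR 0 1 0 x \<inter> CR 0 0 1 x"
proof -
  obtain n where Q: "quaternionic_hyperplane (incl_deriv M X x) n (I x) (J x) (K x)"
    using assms by (rule quaternionic_hyperplane_at)
  show ?thesis
    unfolding cr_space_eq[OF Q] using quaternionic_hyperplane.Greatest_invariant_subspace[OF Q]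
    by (simp add: quaternionic_distribution_def)
qed

text \<open>Three eliminations, with the forms for \<open>I\<close>, \<open>J\<close> and
  \<open>K\<close>, cut the coordinate frame of a chart down to a frame of the common kernel
  \<open>H\<close>. Each removes one index from \<open>Basis\<close>, hence the count.\<close>

lemma quaternionic_frame:
  assumes spc: "\<forall>a b c. a\<^sup>2 + b\<^sup>2 + c\<^sup>2 = 1 \<longrightarrow>
      strictly_pseudoconvex M X (\<lambda>x v. a *\<^sub>R I x v + b *\<^sub>R J x v + c *\<^sub>R K x v)"
    and x: "x \<in> carrier M"
  obtains U V and A :: "'f set" where "x \<in> U" "local_frame M U A V H" "card A + 3 = DIM('f)"
proof -
  have mM: "smooth_manifold M"
    using M by (auto simp: real_hypersurface_def submanifold_def)
  obtain n where "quaternionic_hyperplane (incl_deriv M X x) n (I x) (J x) (K x)"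
    using x by (rule quaternionic_hyperplane_at)
  then interpret Q: quaternionic_hyperplane "incl_deriv M X x" n "I x" "J x" "K x" .
  note cr = cr_space_eq[OF Q.quaternionic_hyperplane_axioms]
  have form: "\<exists>U \<theta>. openin (mtop M) U \<and> x \<in> U \<and> smooth_one_form_on M U \<theta> \<and>
      (\<forall>y\<in>U. {v. \<theta> y v = 0} = CR a b c y)" if "a\<^sup>2 + b\<^sup>2 + c\<^sup>2 = 1" for a b c
    using spc[rule_format, OF that] x unfolding strictly_pseudoconvex_def by meson
  have unit: "(1::real)\<^sup>2 + 0\<^sup>2 + 0\<^sup>2 = 1" "(0::real)\<^sup>2 + 1\<^sup>2 + 0\<^sup>2 = 1" "(0::real)\<^sup>2 + 0\<^sup>2 + 1\<^sup>2 = 1"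
    by simp_all
  obtain U1 \<theta>1 where U1: "openin (mtop M) U1" "x \<in> U1" "smooth_one_form_on M U1 \<theta>1"
      "\<And>y. y \<in> U1 \<Longrightarrow> {v. \<theta>1 y v = 0} = CR 1 0 0 y"
    using form[OF unit(1)] by blast
  obtain U2 \<theta>2 where U2: "openin (mtop M) U2" "x \<in> U2" "smooth_one_form_on M U2 \<theta>2"
      "\<And>y. y \<in> U2 \<Longrightarrow> {v. \<theta>2 y v = 0} = CR 0 1 0 y"
    using form[OF unit(2)] by blast
  obtain U3 \<theta>3 where U3: "openin (mtop M) U3" "x \<in> U3" "smooth_one_form_on M U3 \<theta>3"
      "\<And>y. y \<in> U3 \<Longrightarrow> {v. \<theta>3 y v = 0} = CR 0 0 1 y"
    using form[OF unit(3)] by blast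
  let ?d = "chart_at M x"
  define U where "U = cdom ?d \<inter> (U1 \<inter> U2 \<inter> U3)"
  have d: "?d \<in> atlas M" "x \<in> cdom ?d"
    using chart_at[OF mM x] by auto
  have U: "openin (mtop M) U" and xU: "x \<in> U"
    using U1(1,2) U2(1,2) U3(1,2) d openin_cdom[OF atlas_chart_of[OF mM d(1)]] by (auto simp: U_def)
  have sub: "U \<subseteq> U1" "U \<subseteq> U2" "U \<subseteq> U3" "U \<subseteq> cdom ?d"
    by (auto simp: U_def)
  have mem: "\<theta>1 y v = 0 \<longleftrightarrow> v \<in> CR 1 0 0 y" "\<theta>2 y v = 0 \<longleftrightarrow> v \<in> CR 0 1 0 y"
    "\<theta>3 y v = 0 \<longleftrightarrow> v \<in> CR 0 0 1 y" if "y \<in> U" for y v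
    using that U1(4) U2(4) U3(4) sub by blast+
  have F0: "local_frame M U Basis (\<lambda>b y. tvec M ?d y b) (\<lambda>y. UNIV)"
    using local_frame_tangent[OF mM d(1)] U sub(4) by (rule local_frame_subset)
  note mem_x = mem[OF xU, unfolded cr]
  obtain v1 where v1: "\<theta>1 x v1 \<noteq> 0"
    unfolding mem_x using Q.cr_independent(1) by blast
  obtain W1 and i1 :: 'f and V1 where W1: "W1 \<subseteq> U" "x \<in> W1" "i1 \<in> Basis"
      "local_frame M W1 (Basis - {i1}) V1 (\<lambda>y. {v \<in> UNIV. \<theta>1 y v = 0})"
    by (rule local_frame_kernel[OF mM F0 smooth_one_form_on_subset[OF U1(3) sub(1)] xU UNIV_I v1])
  obtain v2 where v2: "v2 \<in> {v \<in> UNIV. \<theta>1 x v = 0}" "\<theta>2 x v2 \<noteq> 0"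
    unfolding mem_Collect_eq mem_x using Q.cr_independent(2) by blast
  have \<theta>2: "smooth_one_form_on M W1 \<theta>2"
    using U2(3) W1(1) sub(2) by (blast intro: smooth_one_form_on_subset)
  obtain W2 i2 V2 where W2: "W2 \<subseteq> W1" "x \<in> W2" "i2 \<in> Basis - {i1}"
      "local_frame M W2 (Basis - {i1} - {i2}) V2 (\<lambda>y. {v \<in> {v \<in> UNIV. \<theta>1 y v = 0}. \<theta>2 y v = 0})"
    by (rule local_frame_kernel[OF mM W1(4) \<theta>2 W1(2) v2])
  obtain v3 where v3: "v3 \<in> {v \<in> {v \<in> UNIV. \<theta>1 x v = 0}. \<theta>2 x v = 0}" "\<theta>3 x v3 \<noteq> 0"
    unfolding mem_Collect_eq mem_x using Q.cr_independent(3) by blast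
  have \<theta>3: "smooth_one_form_on M W2 \<theta>3"
    using U3(3) W1(1) W2(1) sub(3) by (blast intro: smooth_one_form_on_subset)
  obtain W3 i3 V3 where W3: "W3 \<subseteq> W2" "x \<in> W3" "i3 \<in> Basis - {i1} - {i2}"
      "local_frame M W3 (Basis - {i1} - {i2} - {i3}) V3
        (\<lambda>y. {v \<in> {v \<in> {v \<in> UNIV. \<theta>1 y v = 0}. \<theta>2 y v = 0}. \<theta>3 y v = 0})"
    by (rule local_frame_kernel[OF mM W2(4) \<theta>3 W2(2) v3])
  have "local_frame M W3 (Basis - {i1} - {i2} - {i3}) V3 H"
  proof (rule local_frame_cong[OF W3(4)])
    fix y assume "y \<in> W3"
    then have y: "y \<in> U"
      using W1(1) W2(1) W3(1) by blast
    then have "y \<in> carrier M"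
      using U openin_subset unfolding carrier_def by blast
    then show "{v \<in> {v \<in> {v \<in> UNIV. \<theta>1 y v = 0}. \<theta>2 y v = 0}. \<theta>3 y v = 0} = H y"
      unfolding quaternionic_distribution_eq[OF \<open>y \<in> carrier M\<close>] mem[OF y] by blast
  qed
  moreover have "card (Basis - {i1} - {i2} - {i3}) + 3 = DIM('f)"
  proof -
    have "card {i1, i2, i3} = 3" "{i1, i2, i3} \<subseteq> Basis"
      using W1(3) W2(3) W3(3) by auto
    moreover have "Basis - {i1} - {i2} - {i3} = Basis - {i1, i2, i3}"
      by auto
    ultimately show ?thesis
      using card_mono[of Basis "{i1, i2, i3}"] by (simp add: card_Diff_subset)
  qed
  ultimately show ?thesis
    using W3(2) that by blast
qed

end

theorem proposition7:
  fixes X :: "('x, 'e::euclidean_space) manifold"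
    and M :: "('x, 'f::euclidean_space) manifold"
    and I J K :: "'x \<Rightarrow> 'e \<Rightarrow> 'e"
  assumes "hypercomplex_manifold X I J K"
    and "real_hypersurface M X"
    and "\<And>a b c :: real. a\<^sup>2 + b\<^sup>2 + c\<^sup>2 = 1 \<Longrightarrow>
           strictly_pseudoconvex M X (\<lambda>x v. a *\<^sub>R I x v + b *\<^sub>R J x v + c *\<^sub>R K x v)"
  shows "three_polycontact_structure M (quaternionic_distribution M X I J K)"
proof -
  note X = assms(1) and M = assms(2) and spc = assms(3)
  let ?H = "quaternionic_distribution M X I J K"
  have mM: "smooth_manifold M"
    using M by (auto simp: real_hypersurface_def submanifold_def)

  \<comment> \<open>Local frames and corank three\<close>
  have frame: "\<exists>U (A :: 'f set) V. x \<in> U \<and> local_frame M U A V ?H \<and> card A + 3 = DIM('f)"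
    if "x \<in> carrier M" for x
  proof -
    have "\<forall>a b c. a\<^sup>2 + b\<^sup>2 + c\<^sup>2 = 1 \<longrightarrow>
        strictly_pseudoconvex M X (\<lambda>x v. a *\<^sub>R I x v + b *\<^sub>R J x v + c *\<^sub>R K x v)"
      using spc by blast
    from quaternionic_frame[OF X M this that] show ?thesis
      by metis
  qed
  have codim: "DIM('f) - dim (?H x) = 3" if x: "x \<in> carrier M" for x
  proof -
    obtain U V and A :: "'f set" where "x \<in> U" "local_frame M U A V ?H" "card A + 3 = DIM('f)"
      using frame[OF x] by blast
    \<comment> \<open>As \<open>card A + 3\<close> equals \<open>DIM('f)\<close>, the truncated
      subtraction is exact.\<close>
    then show ?thesis
      using dim_local_frame[of M U A V ?H x] by simp
  qed

  \<comment> \<open>Nondegeneracy of the exterior derivative on the distribution\<close>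
  have nondegenerate: "u = 0"
    if U: "openin (mtop M) U" and \<theta>: "smooth_one_form_on M U \<theta>"
      and vanish: "\<forall>x\<in>U. \<forall>v\<in>?H x. \<theta> x v = 0" and nonzero: "\<forall>x\<in>U. \<exists>v. \<theta> x v \<noteq> 0"
      and x: "x \<in> U" and u: "u \<in> ?H x" and kernel: "\<forall>v\<in>?H x. ext_deriv M \<theta> x u v = 0"
    for U \<theta> x u
  proof (rule ccontr)
    assume "u \<noteq> 0"
    have xM: "x \<in> carrier M"
      using U x openin_subset unfolding carrier_def by blast
    obtain n where "quaternionic_hyperplane (incl_deriv M X x) n (I x) (J x) (K x)"
      using X M xM by (rule quaternionic_hyperplane_at)
    then interpret Q: quaternionic_hyperplane "incl_deriv M X x" n "I x" "J x" "K x" .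
    note cr = cr_space_eq[OF X M Q.quaternionic_hyperplane_axioms]
    have H: "?H x = Q.invariant_core"
      unfolding quaternionic_distribution_eq[OF X M xM] cr ..
    have lin: "linear (\<theta> x)"
      using \<theta> x by (simp add: smooth_one_form_on_def)
    obtain w where "\<theta> x w \<noteq> 0"
      using nonzero x by blast
    moreover have "\<theta> x v = 0" if "v \<in> Q.invariant_core" for v
      using vanish x that unfolding H[symmetric] by blast
    \<comment> \<open>This selects the complex structure whose pseudoconvexity is used. The triple
      depends on \<open>x\<close> but is then held fixed near \<open>x\<close>.\<close>
    ultimately obtain a b c where abc: "a\<^sup>2 + b\<^sup>2 + c\<^sup>2 = 1" "{v. \<theta> x v = 0} = Q.cr a b c"
      using Q.functional_vanishing_on_core[OF lin] by metis
    let ?L = "\<lambda>x v. a *\<^sub>R I x v + b *\<^sub>R J x v + c *\<^sub>R K x v"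
    obtain W \<eta> where W: "openin (mtop M) W" "x \<in> W" and \<eta>: "smooth_one_form_on M W \<eta>"
      and ker: "\<And>y. y \<in> W \<Longrightarrow> {v. \<eta> y v = 0} = cr_space M X ?L y"
      and pos: "\<And>v. v \<in> cr_space M X ?L x \<Longrightarrow> v \<noteq> 0 \<Longrightarrow> Re (levi_form M X ?L \<eta> x v v) > 0"
      using spc[OF abc(1)] xM unfolding strictly_pseudoconvex_def by meson
    have lin': "linear (\<eta> x)"
      using \<eta> W(2) by (simp add: smooth_one_form_on_def)
    have same_kernel: "\<eta> x v = 0 \<longleftrightarrow> \<theta> x v = 0" for v
      using ker[OF W(2)] abc(2) unfolding cr by blast
    \<comment> \<open>Equal kernels make the two covectors at \<open>x\<close> proportional; at
      other points \<theta> and \<eta> need not be.\<close>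
    obtain s where s: "\<And>v. \<theta> x v = s * \<eta> x v"
      using linear_functional_factor[OF lin' lin subspace_UNIV] same_kernel by (metis UNIV_I)
    have "s \<noteq> 0"
      using s[of w] \<open>\<theta> x w \<noteq> 0\<close> by auto
    obtain V V' and A :: "'f set" where V: "x \<in> V" "local_frame M V A V' ?H"
      using frame[OF xM] by blast
    \<comment> \<open>The comparison of exterior derivatives takes place on one neighbourhood where
      both forms annihilate the distribution and a frame exists.\<close>
    define Z where "Z = U \<inter> W \<inter> V"
    have Z: "openin (mtop M) Z" "x \<in> Z" "Z \<subseteq> U" "Z \<subseteq> W" "Z \<subseteq> V"
      using U W V x local_frame_openin[OF V(2)] by (auto simp: Z_def)
    \<comment> \<open>Under the inclusion \<open>v\<close> is L u. It lies in the distribution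
      because the core is invariant, so it can be tested against \<open>kernel\<close>.\<close>
    obtain v where v: "v \<in> Q.invariant_core" "Q.comb a b c (incl_deriv M X x u) = incl_deriv M X x v"
      using u unfolding H by (rule Q.core_invariant)
    have "cr_operator M X ?L x u = v"
      using v(2) Q.\<iota>(2) by (simp add: cr_operator_def Q.comb_def)
    moreover have "u \<in> cr_space M X ?L x"
      using u Q.core_subset_cr[OF abc(1)] unfolding H cr by blast
    ultimately have "ext_deriv M \<eta> x u v > 0"
      using pos[of u] \<open>u \<noteq> 0\<close> by (simp add: levi_form_def)
    moreover have "ext_deriv M \<theta> x u v = s * ext_deriv M \<eta> x u v"
    proof (rule ext_deriv_annihilator[OF mM])
      show "local_frame M Z A V' ?H"
        using V(2) Z(1,5) by (rule local_frame_subset)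
      show "smooth_one_form_on M Z \<theta>" "smooth_one_form_on M Z \<eta>"
        using \<theta> \<eta> Z(3,4) by (blast intro: smooth_one_form_on_subset)+
      show "\<theta> y v = 0" if "y \<in> Z" "v \<in> ?H y" for y v
        using vanish that Z(3) by blast
      \<comment> \<open>Since derivatives enter, \<eta> has to annihilate the distribution at all
        points near \<open>x\<close>; it does, as the core lies in the CR space of every unit
        combination at each point.\<close>
      show "\<eta> y v = 0" if y: "y \<in> Z" and v: "v \<in> ?H y" for y v
      proof -
        have yM: "y \<in> carrier M"
          using y Z(1) openin_subset unfolding carrier_def by blast
        obtain n where Qy: "quaternionic_hyperplane (incl_deriv M X y) n (I y) (J y) (K y)"
          using X M yM by (rule quaternionic_hyperplane_at)
        have "?H y \<subseteq> cr_space M X ?L y"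
          unfolding quaternionic_distribution_eq[OF X M yM] cr_space_eq[OF X M Qy]
          by (rule quaternionic_hyperplane.core_subset_cr[OF Qy abc(1)])
        then show ?thesis
          using v y Z(4) ker by blast
      qed
    qed (use s u v(1) Z(2) H in auto)
    moreover have "ext_deriv M \<theta> x u v = 0"
      using kernel v(1) unfolding H by blast
    ultimately show False
      using \<open>s \<noteq> 0\<close> by simp
  qed
  have smooth: "smooth_distribution M ?H"
  proof (rule local_frame_imp_smooth_distribution)
    show "\<exists>U (A :: 'f set) V. x \<in> U \<and> local_frame M U A V ?H" if "x \<in> carrier M" for x
      using frame[OF that] by blast
  qed
  show ?thesis
    unfolding three_polycontact_structure_def polycontact_structure_def
  proof (intro conjI allI impI ballI smooth codim)
    show "1 \<le> DIM('f) - dim (?H x)" if "x \<in> carrier M" for x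
      using codim[OF that] by simp
  qed (rule nondegenerate)
qed

end
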